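(* If $p=2$ then $M=\varnothing$. If $p\ne 2$, then $\phi_2$ has degree $p-2$ (i.e. for every $q\in\phi_2(M)$ the fiber $\phi_2^{-1}(q)$ has exactly $p-2$ points counted with multiplicity), and $$\phi_2(M)=B(1,p^{-1/(p-1)})\setminus B(1,p^{-1/(p-2)}).$$
   Context: Let $p$ be a prime, $\mathbb{C}_p$ the $p$-adic complex numbers with absolute value $|\cdot|$ and additive valuation $v$, $|x|=p^{-v(x)}$, $v(p)=1$. Let $O_p=\{x\in\mathbb{C}_p:|x|\le 1\}$ and $B(a,r)=\{b\in\mathbb{C}_p:|b-a|<r\}$. For $x\in O_p$ and $q\in B(1,p^{-1/(p-1)})$ put $q^x=\exp(x\log q)$ ($p$-adic $\exp$ and $\log$), and define the $q$-bracket by $[x]_q=\frac{q^x-1}{q-1}$ if $q\ne 1$ and $[x]_1=x$. The equation $[x]_q=x$ has the trivial solutions $q=1$, $x=0$, $x=1$. To remove them, let $g(X,Q)=\frac{[X]_Q-X}{(Q-1)X(X-1)}$, understood as the analytic function on $O_p\times B(1,p^{-1/(p-1)})$ given by the convergent series $g(X,Q)=\sum_{n\ge 0}\frac{A_n(X)}{(n+2)!}(Q-1)^n$, where $A_0(X)=1$ and $A_n(X)=(X-2)(X-3)\cdots(X-(n+1))$ for $n>0$. Define $M=\{(x,q)\in O_p\times B(1,p^{-1/(p-1)}): g(x,q)=0\}$ (the set of nontrivial fixed points), and let $\phi_2:M\to B(1,p^{-1/(p-1)})$ be the projection $(x,q)\mapsto q$. The multiplicity of a point $(x,q)$ in the fiber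 $\phi_2^{-1}(q)$ is the order of vanishing at $X=x$ of the one-variable analytic function $g(X,q)$. *)

theory Defs
  imports "HOL-Analysis.Analysis" "HOL-Computational_Algebra.Computational_Algebra"
begin

text \<open>
  The absolute value of a valued field is encoded as the distance to 0, so that the notions of
  the metric type classes (completeness, closure, balls, series) apply to it.
\<close>

definition absv :: "'a::{field_char_0, metric_space} \<Rightarrow> real" where
  "absv x = dist x 0"

text \<open>
  Inside a complete field whose absolute value restricts to the p-adic one on the rationals, the
  topological closure of the rationals is their completion, the field of p-adic numbers.
\<close>

definition padic_numbers :: "'a::{field_char_0, metric_space} set" where
  "padic_numbers = closure \<rat>"

definition padic_algebraic :: "'a::{field_char_0, metric_space} set" where
  "padic_algebraic =
     {x. \<exists>f. f \<noteq> 0 \<and> (\<forall>i. coeff f i \<in> padic_numbers) \<and> poly f x = 0}"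

text \<open>
  The type is a copy of the p-adic complex numbers, i.e. a completion of an algebraic closure of
  the field of p-adic numbers, with the absolute value normalised by |p| = 1/p. Completeness is
  part of the sort. The elements algebraic over the p-adic numbers are required to form an
  algebraically closed field (hence an algebraic closure) which is dense.
\<close>

definition padic_complex_field ::
    "nat \<Rightarrow> 'a::{field_char_0, complete_space} itself \<Rightarrow> bool" where
  "padic_complex_field p K \<longleftrightarrow>
     (\<forall>x y :: 'a. dist x y = absv (x - y)) \<and>
     (\<forall>x y :: 'a. absv (x * y) = absv x * absv y) \<and>
     (\<forall>x y :: 'a. absv (x + y) \<le> max (absv x) (absv y)) \<and>
     absv (of_nat p :: 'a) = 1 / real p \<and>
     (\<forall>f :: 'a poly. degree f > 0 \<and> (\<forall>i. coeff f i \<in> padic_algebraic) \<longrightarrow>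
        (\<exists>x \<in> padic_algebraic. poly f x = 0)) \<and>
     closure (padic_algebraic :: 'a set) = UNIV"

text \<open>
  Expanding \<open>Q\<^sup>X = exp (X * log Q)\<close> as the binomial series in \<open>Q - 1\<close> turns
  \<open>([X]\<^sub>Q - X) / ((Q - 1) * X * (X - 1))\<close>, with \<open>[X]\<^sub>Q = (Q\<^sup>X - 1) / (Q - 1)\<close>, into the
  series below, which also gives a meaning to the quotient for \<open>Q = 1\<close>, \<open>X = 0\<close> and \<open>X = 1\<close>.
\<close>

definition g_coeff :: "nat \<Rightarrow> 'a::field_char_0 \<Rightarrow> 'a" where
  "g_coeff n X = (\<Prod>k = 2..n + 1. X - of_nat k)"

definition g :: "'a::{field_char_0, metric_space} \<Rightarrow> 'a \<Rightarrow> 'a" where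
  "g X Q = (\<Sum>n. g_coeff n X / fact (n + 2) * (Q - 1) ^ n)"

text \<open>
  Since the absolute value is the distance to 0, \<open>cball 0 1\<close> is the ring of integers.
\<close>

definition nontrivial_fixed_points :: "nat \<Rightarrow> ('a::{field_char_0, metric_space} \<times> 'a) set" where
  "nontrivial_fixed_points p =
     {(x, q). x \<in> cball 0 1 \<and> q \<in> ball 1 (real p powr (- 1 / (real p - 1))) \<and> g x q = 0}"

text \<open>
  The order of vanishing is the index of the first nonzero coefficient of a power series expansion.
  A function that is not analytic at the point, or vanishes near it, gets no specified value.
\<close>

definition has_power_series_at ::
    "('a::{field_char_0, metric_space} \<Rightarrow> 'a) \<Rightarrow> 'a fps \<Rightarrow> 'a \<Rightarrow> bool" where
  "has_power_series_at f F x \<longleftrightarrow>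
     (\<exists>r>0. \<forall>y \<in> ball x r. (\<lambda>n. fps_nth F n * (y - x) ^ n) sums f y)"

definition vanishing_order :: "('a::{field_char_0, metric_space} \<Rightarrow> 'a) \<Rightarrow> 'a \<Rightarrow> nat" where
  "vanishing_order f x =
     (THE n. \<exists>F. F \<noteq> 0 \<and> has_power_series_at f F x \<and> subdegree F = n)"

end

theory Submission
  imports Defs
begin

text \<open>
  Fix \<open>q\<close> in the disc of convergence and put \<open>u = q - 1\<close>. The function \<open>g X q\<close> is the Newton series
  \<open>\<Sum>n. c\<^sub>n (X - 2) \<dots> (X - (n + 1))\<close> with \<open>c\<^sub>n = u\<^sup>n / (n + 2)!\<close>. Rewritten in powers of \<open>X\<close> it is
  a power series whose coefficients tend to 0, so it converges on the whole unit ball, and what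
  decides its zeros there is its Weierstrass degree: the last index \<open>d\<close> at which the coefficients
  attain their maximal absolute value. Such a series has exactly \<open>d\<close> zeros in the unit ball,
  counted with multiplicity (\<open>zero_count\<close>). The change of basis from powers to monic integral
  polynomials of degree \<open>n\<close> is unitriangular, so it preserves the degree
  (\<open>regroup_weierstrass_degree\<close>), and the degree can be read off the \<open>c\<^sub>n\<close>.

  That is a computation with \<open>v (m!) \<le> (m - 1) / (p - 1)\<close>. With \<open>s = p powr (1 / (p - 1))\<close> it gives
  \<open>|c\<^sub>n| \<le> s (s |u|)\<^sup>n\<close>, where \<open>s |u| < 1\<close>, with equality at \<open>n = p - 2\<close>, so for \<open>u \<noteq> 0\<close> all later
  coefficients are strictly smaller. For odd \<open>p\<close> the earlier ones have absolute value \<open>|u|\<^sup>n\<close>, so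
  \<open>c\<^sub>0\<close>, of absolute value 1, is the largest of them. The degree is thus decided by comparing
  \<open>|c\<^sub>0| = 1\<close> with \<open>|c\<^bsub>p-2\<^esub>| = p |u|\<^bsup>p-2\<^esup>\<close>: it is \<open>p - 2\<close> if \<open>|u| \<ge> p powr (- 1 / (p - 2))\<close> and 0 otherwise. For
  \<open>p = 2\<close> both indices coincide and the degree is always 0.

  The count of zeros is an induction on \<open>d\<close>. Dividing by \<open>X - a\<close> for a zero \<open>a\<close> lowers the degree by
  one (\<open>linear_quotient_weierstrass_degree\<close>) and the vanishing order at \<open>a\<close> by one
  (\<open>vanishing_order_times_linear\<close>), and a series of degree 0 has no zeros since its constant term
  dominates. What remains is that a series \<open>f\<close> of positive degree has a zero (\<open>zero_exists\<close>).
  Polynomials that split into linear factors are dense among all polynomials, because polynomials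
  with coefficients in a dense algebraically closed subfield have roots. A split polynomial close to
  \<open>f\<close> has exactly \<open>d\<close> roots in the unit ball, and the product of the distances from a point \<open>y\<close> to
  these roots is \<open>|f y|\<close> up to a constant factor and a small error; hence an approximate zero has a
  much better one nearby, and iterating yields a Cauchy sequence that converges to a zero.
\<close>

section \<open>Limits and series in an ultrametric field\<close>

lemma null_seq_iff:
  "c \<longlonglongrightarrow> (0::'a::{field_char_0, metric_space}) \<longleftrightarrow> (\<forall>e>0. \<exists>N. \<forall>n\<ge>N. absv (c n) < e)"
  by (simp add: lim_sequentially absv_def)

lemma null_seq_iff_absv:
  "c \<longlonglongrightarrow> (0::'a::{field_char_0, metric_space}) \<longleftrightarrow> (\<lambda>n. absv (c n)) \<longlonglongrightarrow> 0"
  unfolding absv_def by (rule tendsto_dist_iff)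

text \<open>
  The metric type classes do not link the distance to the field operations, so sums of limits and of
  series are derived here from the ultrametric inequality. Nontriviality makes nonzero elements of
  arbitrarily small absolute value available; without them every point would be isolated and a
  function would not determine its power series.
\<close>

locale ultrametric_field =
  fixes K :: "'a::{field_char_0, complete_space} itself"
  assumes dist_absv: "\<And>x y :: 'a. dist x y = absv (x - y)"
    and absv_mult: "\<And>x y :: 'a. absv (x * y) = absv x * absv y"
    and absv_add_le: "\<And>x y :: 'a. absv (x + y) \<le> max (absv x) (absv y)"
    and nontrivial: "\<exists>\<pi> :: 'a. \<pi> \<noteq> 0 \<and> absv \<pi> < 1"
begin

lemma absv_zero_iff [simp]: "absv (x::'a) = 0 \<longleftrightarrow> x = 0"
  by (simp add: absv_def)

lemma absv_0 [simp]: "absv (0::'a) = 0"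
  by simp

lemma absv_nonneg [simp]: "0 \<le> absv (x::'a)"
  by (simp add: absv_def)

lemma absv_pos_iff [simp]: "0 < absv (x::'a) \<longleftrightarrow> x \<noteq> 0"
  by (simp add: absv_def)

lemma absv_one [simp]: "absv (1::'a) = 1"
  using absv_mult[of 1 1] by simp

lemma absv_minus [simp]: "absv (- x) = absv (x::'a)"
  using dist_absv[of 0 x] by (simp add: absv_def dist_commute)

lemma absv_minus_commute: "absv (x - y) = absv (y - x :: 'a)"
  using absv_minus[of "x - y"] by simp

lemma absv_diff_le: "absv (x - y :: 'a) \<le> max (absv x) (absv y)"
  using absv_add_le[of x "- y"] by simp

lemma absv_add_leI: "absv (x::'a) \<le> B \<Longrightarrow> absv y \<le> B \<Longrightarrow> absv (x + y) \<le> B"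
  using absv_add_le[of x y] by linarith

lemma absv_add_lessI: "absv (x::'a) < B \<Longrightarrow> absv y < B \<Longrightarrow> absv (x + y) < B"
  using absv_add_le[of x y] by linarith

lemma absv_diff_leI: "absv (x::'a) \<le> B \<Longrightarrow> absv y \<le> B \<Longrightarrow> absv (x - y) \<le> B"
  using absv_diff_le[of x y] by linarith

lemma absv_diff_lessI: "absv (x::'a) < B \<Longrightarrow> absv y < B \<Longrightarrow> absv (x - y) < B"
  using absv_diff_le[of x y] by linarith

text \<open>
  The strongest summand wins: this is how one dominant term determines the absolute value of a
  polynomial or a series.
\<close>

lemma absv_add_eq_left:
  assumes "absv (y::'a) < absv x"
  shows "absv (x + y) = absv x"
  using absv_add_le[of x y] absv_diff_le[of "x + y" y] assms by simp

lemma absv_power: "absv (x ^ n :: 'a) = absv x ^ n"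
  by (induction n) (simp_all add: absv_mult)

lemma absv_inverse: "absv (inverse x :: 'a) = inverse (absv x)"
proof (cases "x = 0")
  case False
  then show ?thesis
    using absv_mult[of x "inverse x"] by (simp add: inverse_eq_divide field_simps)
qed (simp add: absv_def)

lemma absv_divide: "absv (x / y :: 'a) = absv x / absv y"
  by (simp add: divide_inverse absv_mult absv_inverse)

lemma absv_sum_leI:
  assumes "\<And>i. i \<in> A \<Longrightarrow> absv (f i :: 'a) \<le> B" and "0 \<le> B"
  shows "absv (sum f A) \<le> B"
  using assms
proof (induction A rule: infinite_finite_induct)
  case (insert x F)
  then show ?case by (auto intro: absv_add_leI)
qed simp_all

lemma absv_of_nat_le_1: "absv (of_nat n :: 'a) \<le> 1"
  by (induction n) (auto intro: absv_add_leI)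

lemma mem_unit_ball_iff: "(x::'a) \<in> cball 0 1 \<longleftrightarrow> absv x \<le> 1"
  by (simp add: absv_def dist_commute)

lemma absv_mult_le_left: "absv (x::'a) \<le> 1 \<Longrightarrow> absv (y * x) \<le> absv y"
  by (simp add: absv_mult mult_left_le)

lemma null_seq_le:
  assumes "b \<longlonglongrightarrow> (0::'a)" and "\<And>n. absv (c n :: 'a) \<le> absv (b n)"
  shows "c \<longlonglongrightarrow> 0"
  unfolding null_seq_iff
proof (intro allI impI)
  fix e :: real assume "0 < e"
  then obtain N where "\<forall>n\<ge>N. absv (b n) < e"
    using assms(1) unfolding null_seq_iff by blast
  then show "\<exists>N. \<forall>n\<ge>N. absv (c n) < e"
    using le_less_trans[OF assms(2)] by blast
qed

lemma tendsto_add_ultra: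
  assumes "X \<longlonglongrightarrow> (a::'a)" and "Y \<longlonglongrightarrow> b"
  shows "(\<lambda>n. X n + Y n) \<longlonglongrightarrow> a + b"
proof -
  have "(\<lambda>n. max (dist (X n) a) (dist (Y n) b)) \<longlonglongrightarrow> max 0 0"
    using assms by (intro tendsto_max) (simp_all only: tendsto_dist_iff[symmetric])
  then have lim: "(\<lambda>n. max (dist (X n) a) (dist (Y n) b)) \<longlonglongrightarrow> 0"
    by simp
  have "norm (dist (X n + Y n) (a + b)) \<le> max (dist (X n) a) (dist (Y n) b)" for n
    using absv_add_le[of "X n - a" "Y n - b"] by (simp add: dist_absv algebra_simps)
  then have "(\<lambda>n. dist (X n + Y n) (a + b)) \<longlonglongrightarrow> 0"
    by (intro Lim_null_comparison[OF always_eventually lim]) blast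
  then show ?thesis by (simp only: tendsto_dist_iff[symmetric])
qed

lemma tendsto_mult_left_ultra:
  assumes "X \<longlonglongrightarrow> (a::'a)"
  shows "(\<lambda>n. c * X n) \<longlonglongrightarrow> c * a"
proof -
  have "(\<lambda>n. absv c * dist (X n) a) \<longlonglongrightarrow> absv c * 0"
    using assms by (intro tendsto_mult_left) (simp only: tendsto_dist_iff[symmetric])
  moreover have "dist (c * X n) (c * a) = absv c * dist (X n) a" for n
    by (simp add: dist_absv flip: absv_mult right_diff_distrib)
  ultimately show ?thesis unfolding tendsto_dist_iff[of "\<lambda>n. c * X n"] by simp
qed

lemma sums_add_ultra: "f sums (a::'a) \<Longrightarrow> h sums b \<Longrightarrow> (\<lambda>n. f n + h n) sums (a + b)"
  unfolding sums_def sum.distrib by (rule tendsto_add_ultra)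

lemma sums_mult_ultra: "f sums (a::'a) \<Longrightarrow> (\<lambda>n. c * f n) sums (c * a)"
  unfolding sums_def sum_distrib_left[symmetric] by (rule tendsto_mult_left_ultra)

lemma sums_diff_ultra: "f sums (a::'a) \<Longrightarrow> h sums b \<Longrightarrow> (\<lambda>n. f n - h n) sums (a - b)"
  using sums_add_ultra[of f a "\<lambda>n. -1 * h n" "-1 * b"] sums_mult_ultra[of h b "-1"] by simp

lemma sums_Suc_ultra:
  assumes "(\<lambda>n. f (Suc n)) sums (a::'a)"
  shows "f sums (f 0 + a)"
proof -
  have "(\<lambda>n. f 0 + (\<Sum>i<n. f (Suc i))) \<longlonglongrightarrow> f 0 + a"
    using assms by (intro tendsto_add_ultra) (simp_all add: sums_def)
  then have "(\<lambda>n. \<Sum>i<Suc n. f i) \<longlonglongrightarrow> f 0 + a"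
    by (simp add: sum.lessThan_Suc_shift del: sum.lessThan_Suc)
  then show ?thesis
    unfolding sums_def by (rule LIMSEQ_imp_Suc)
qed

lemma sums_Suc_iff_ultra: "(\<lambda>n. f (Suc n)) sums a \<longleftrightarrow> f sums (f 0 + a :: 'a)"
proof
  assume f: "f sums (f 0 + a)"
  have "(\<lambda>n. - f 0 + (\<Sum>i<Suc n. f i)) \<longlonglongrightarrow> - f 0 + (f 0 + a)"
    using f unfolding sums_def by (intro tendsto_add_ultra tendsto_const LIMSEQ_Suc)
  then show "(\<lambda>n. f (Suc n)) sums a"
    by (simp add: sums_def sum.lessThan_Suc_shift del: sum.lessThan_Suc)
qed (rule sums_Suc_ultra)

text \<open>
  By the ultrametric inequality \<open>|X\<^sub>m - X\<^sub>n|\<close> is bounded by the largest single step between \<open>m\<close> and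
  \<open>n\<close>, so steps tending to 0 make a Cauchy sequence.
\<close>

lemma convergent_if_steps_null:
  assumes "(\<lambda>n. X (Suc n) - X n) \<longlonglongrightarrow> (0::'a)"
  shows "convergent X"
proof -
  have "Cauchy X"
  proof (rule metric_CauchyI)
    fix e :: real assume e: "0 < e"
    then obtain N where N: "\<And>n. n \<ge> N \<Longrightarrow> absv (X (Suc n) - X n) < e"
      using assms unfolding null_seq_iff by blast
    have to_N: "absv (X n - X N) < e" if "n \<ge> N" for n
      using that
    proof (induction n rule: dec_induct)
      case (step n)
      then show ?case using absv_add_lessI[OF N[of n] step.IH] by simp
    qed (use e in simp)
    have "dist (X m) (X n) < e" if "m \<ge> N" "n \<ge> N" for m n
      using absv_diff_lessI[OF to_N[OF that(1)] to_N[OF that(2)]] by (simp add: dist_absv)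
    then show "\<exists>N. \<forall>m\<ge>N. \<forall>n\<ge>N. dist (X m) (X n) < e" by blast
  qed
  then show ?thesis by (rule Cauchy_convergent)
qed

lemma summable_if_null:
  assumes "f \<longlonglongrightarrow> (0::'a)"
  shows "summable f"
  unfolding summable_iff_convergent
  by (rule convergent_if_steps_null) (use assms in simp)

lemma null_if_sums:
  assumes "f sums (a::'a)"
  shows "f \<longlonglongrightarrow> 0"
proof -
  have "(\<lambda>n. (\<Sum>i<Suc n. f i) + (-1) * (\<Sum>i<n. f i)) \<longlonglongrightarrow> a + (-1) * a"
    using assms unfolding sums_def
    by (intro tendsto_add_ultra tendsto_mult_left_ultra LIMSEQ_Suc)
  then show ?thesis by simp
qed

lemma absv_lim_le:
  assumes "X \<longlonglongrightarrow> (a::'a)" and "\<And>n. absv (X n) \<le> B"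
  shows "absv a \<le> B"
  unfolding absv_def
  by (rule LIMSEQ_le_const2[OF tendsto_dist[OF assms(1) tendsto_const]])
     (use assms(2) in \<open>auto simp: absv_def\<close>)

lemma absv_sums_le:
  assumes "f sums (a::'a)" and "\<And>n. absv (f n) \<le> B"
  shows "absv a \<le> B"
proof -
  have "0 \<le> B" using order_trans[OF absv_nonneg assms(2)] .
  then show ?thesis
    using assms(2) by (intro absv_lim_le[OF assms(1)[unfolded sums_def]] absv_sum_leI)
qed

text \<open>
  A strict bound on the terms passes to the sum because the terms tend to 0: all but finitely many are
  below half the bound, so their supremum is a maximum.
\<close>

lemma absv_sums_less:
  assumes "f sums (a::'a)" and less: "\<And>n. absv (f n) < B"
  shows "absv a < B"
proof -
  have B: "0 < B" using less[of 0] absv_nonneg[of "f 0"] by linarith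
  from null_if_sums[OF assms(1)] obtain N where N: "\<And>n. n \<ge> N \<Longrightarrow> absv (f n) < B / 2"
    unfolding null_seq_iff using B by (meson half_gt_zero)
  define m where "m = Max (insert (B / 2) ((\<lambda>n. absv (f n)) ` {..<N}))"
  have "m < B" unfolding m_def using less B by (subst Max_less_iff) auto
  moreover have "absv (f n) \<le> m" for n
  proof (cases "n < N")
    case False
    then have "absv (f n) \<le> B / 2" using N[of n] by simp
    then show ?thesis unfolding m_def by (intro Max_ge_iff[THEN iffD2]) auto
  qed (auto simp: m_def intro: Max_ge)
  ultimately show ?thesis using absv_sums_le[OF assms(1)] by (meson le_less_trans)
qed

lemma absv_sums_dominant:
  assumes "f sums (a::'a)" and "\<And>n. n \<noteq> k \<Longrightarrow> absv (f n) < absv (f k)" and "f k \<noteq> 0"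
  shows "absv a = absv (f k)"
proof -
  have "(\<lambda>n. f n - (if n = k then f n else 0)) sums (a - f k)"
    by (rule sums_diff_ultra[OF assms(1) sums_single])
  then have "absv (a - f k) < absv (f k)"
    by (rule absv_sums_less) (use assms in auto)
  then show ?thesis using absv_add_eq_left[of "a - f k" "f k"] by simp
qed

lemma absv_sums_tail_le:
  assumes "f sums (a::'a)" and "\<And>n. n \<ge> N \<Longrightarrow> absv (f n) \<le> B" and "0 \<le> B"
  shows "absv (a - (\<Sum>n<N. f n)) \<le> B"
proof -
  have "(\<lambda>n. f n - (if n \<in> {..<N} then f n else 0)) sums (a - (\<Sum>n<N. f n))"
    by (rule sums_diff_ultra[OF assms(1) sums_If_finite_set]) simp
  then show ?thesis
    by (rule absv_sums_le) (use assms in auto)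
qed

end

section \<open>Power series on the unit ball and their Weierstrass degree\<close>

text \<open>
  For coefficients that tend to 0 and do not all vanish there is exactly one such index. It is the
  degree of the reduction modulo the maximal ideal, once the series is scaled to maximal absolute
  value 1.
\<close>

definition weierstrass_degree :: "(nat \<Rightarrow> 'a::{field_char_0, metric_space}) \<Rightarrow> nat \<Rightarrow> bool" where
  "weierstrass_degree c d \<longleftrightarrow>
     c d \<noteq> 0 \<and> (\<forall>n. absv (c n) \<le> absv (c d)) \<and> (\<forall>n>d. absv (c n) < absv (c d))"

definition fps_value :: "'a::{field_char_0, metric_space} fps \<Rightarrow> 'a \<Rightarrow> 'a" where
  "fps_value F z = (\<Sum>n. fps_nth F n * z ^ n)"

definition integral_poly :: "'a::{field_char_0, metric_space} poly \<Rightarrow> bool" where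
  "integral_poly f \<longleftrightarrow> (\<forall>i. absv (coeff f i) \<le> 1)"

text \<open>
  The coefficients of \<open>\<Sum>n. c\<^sub>n P\<^sub>n\<close> in powers of the variable. Taking \<open>P\<^sub>n = (x + X)\<^sup>n\<close> moves the
  center of a power series to \<open>x\<close>; taking the products \<open>(X - 2) \<dots> (X - (n + 1))\<close> expands the Newton
  series of the fixed point equation.
\<close>

definition regroup :: "(nat \<Rightarrow> 'a::{field_char_0, metric_space}) \<Rightarrow> (nat \<Rightarrow> 'a poly) \<Rightarrow> 'a fps" where
  "regroup c P = Abs_fps (\<lambda>m. \<Sum>n. c n * coeff (P n) m)"

text \<open>
  The quotient of the division of \<open>F\<close> by \<open>X - x\<close>; the remainder is the value of \<open>F\<close> at \<open>x\<close>.
\<close>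

definition linear_quotient :: "'a::{field_char_0, metric_space} fps \<Rightarrow> 'a \<Rightarrow> 'a fps" where
  "linear_quotient F x = Abs_fps (\<lambda>n. \<Sum>k. fps_nth F (Suc n + k) * x ^ k)"

context ultrametric_field
begin

lemma absv_mult_power_le: "absv (z::'a) \<le> 1 \<Longrightarrow> absv (a * z ^ n) \<le> absv a"
  by (intro absv_mult_le_left) (simp add: absv_power power_le_one)

lemma null_mult_power:
  "c \<longlonglongrightarrow> (0::'a) \<Longrightarrow> absv z \<le> 1 \<Longrightarrow> (\<lambda>n. c n * z ^ n) \<longlonglongrightarrow> 0"
  by (erule null_seq_le) (rule absv_mult_power_le)

lemma fps_value_sums:
  "fps_nth F \<longlonglongrightarrow> (0::'a) \<Longrightarrow> absv z \<le> 1 \<Longrightarrow> (\<lambda>n. fps_nth F n * z ^ n) sums fps_value F z"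
  unfolding fps_value_def by (intro summable_sums summable_if_null null_mult_power)

lemma absv_fps_value_le:
  assumes "fps_nth F \<longlonglongrightarrow> (0::'a)" "absv z \<le> 1" "\<And>n. absv (fps_nth F n) \<le> B"
  shows "absv (fps_value F z) \<le> B"
  by (rule absv_sums_le[OF fps_value_sums[OF assms(1,2)]])
     (rule order_trans[OF absv_mult_power_le[OF assms(2)] assms(3)])

lemma integral_poly_1: "integral_poly (1 :: 'a poly)"
  by (simp add: integral_poly_def coeff_1)

lemma integral_poly_linear: "absv (a::'a) \<le> 1 \<Longrightarrow> integral_poly [:a, 1:]"
  by (simp add: integral_poly_def coeff_pCons split: nat.split)

lemma integral_poly_mult:
  "integral_poly f \<Longrightarrow> integral_poly h \<Longrightarrow> integral_poly (f * h :: 'a poly)"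
  by (auto simp: integral_poly_def coeff_mult absv_mult mult_le_one intro!: absv_sum_leI)

lemma integral_poly_power: "integral_poly f \<Longrightarrow> integral_poly (f ^ n :: 'a poly)"
  by (induction n) (auto intro: integral_poly_mult integral_poly_1)

lemma integral_poly_prod:
  "(\<And>i. i \<in> A \<Longrightarrow> integral_poly (f i :: 'a poly)) \<Longrightarrow> integral_poly (prod f A)"
  by (induction A rule: infinite_finite_induct) (auto intro: integral_poly_mult integral_poly_1)

lemma absv_poly_le:
  assumes "\<And>i. absv (coeff f i :: 'a) \<le> B" and "absv z \<le> 1"
  shows "absv (poly f z) \<le> B"
proof -
  have "0 \<le> B" using order_trans[OF absv_nonneg assms(1)] .
  then show ?thesis
    unfolding poly_altdef
    by (intro absv_sum_leI order_trans[OF absv_mult_power_le[OF assms(2)] assms(1)])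
qed

lemma poly_sums: "(\<lambda>m. coeff f m * z ^ m) sums poly f (z::'a)"
  unfolding poly_altdef by (rule sums_finite) (simp_all add: coeff_eq_0)

lemma regroup_sums:
  assumes "c \<longlonglongrightarrow> (0::'a)" and "\<And>n. integral_poly (P n)"
  shows "(\<lambda>n. c n * coeff (P n) m) sums fps_nth (regroup c P) m"
proof -
  have "(\<lambda>n. c n * coeff (P n) m) \<longlonglongrightarrow> 0"
    using assms(2) by (intro null_seq_le[OF assms(1)] absv_mult_le_left) (simp add: integral_poly_def)
  then show ?thesis
    unfolding regroup_def by (simp add: summable_if_null summable_sums)
qed

lemma regroup_null:
  assumes "c \<longlonglongrightarrow> (0::'a)" and "\<And>n. integral_poly (P n)" and deg: "\<And>n. degree (P n) \<le> n"
  shows "fps_nth (regroup c P) \<longlonglongrightarrow> 0"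
  unfolding null_seq_iff
proof (intro allI impI)
  fix e :: real assume e: "0 < e"
  then obtain N where N: "\<And>n. n \<ge> N \<Longrightarrow> absv (c n) < e"
    using assms(1) unfolding null_seq_iff by blast
  have "absv (fps_nth (regroup c P) m) < e" if "m \<ge> N" for m
  proof (rule absv_sums_less[OF regroup_sums[OF assms(1,2)]])
    fix n show "absv (c n * coeff (P n) m) < e"
    proof (cases "n < m")
      case True
      then have "coeff (P n) m = 0" by (intro coeff_eq_0 le_less_trans[OF deg])
      then show ?thesis using e by simp
    next
      case False
      have "absv (c n * coeff (P n) m) \<le> absv (c n)"
        using assms(2) by (intro absv_mult_le_left) (simp add: integral_poly_def)
      then show ?thesis using N[of n] False that by linarith
    qed
  qed
  then show "\<exists>N. \<forall>m\<ge>N. absv (fps_nth (regroup c P) m) < e" by blast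
qed

text \<open>
  Interchanging the two summations: cutting the sum over \<open>n\<close> at \<open>N\<close> leaves a polynomial, and the error
  is bounded by \<open>e\<close> both in the value and, uniformly, in every coefficient.
\<close>

lemma regroup_value:
  assumes c: "c \<longlonglongrightarrow> (0::'a)" and P: "\<And>n. integral_poly (P n)" and deg: "\<And>n. degree (P n) \<le> n"
    and z: "absv z \<le> 1"
  shows "(\<lambda>n. c n * poly (P n) z) sums fps_value (regroup c P) z"
proof -
  have coeff_sums: "(\<lambda>n. c n * coeff (P n) m) sums fps_nth (regroup c P) m" for m
    by (rule regroup_sums[OF c P])
  have "(\<lambda>n. c n * poly (P n) z) \<longlonglongrightarrow> 0"
    using P z by (intro null_seq_le[OF c] absv_mult_le_left absv_poly_le) (simp_all add: integral_poly_def)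
  then obtain S where S: "(\<lambda>n. c n * poly (P n) z) sums S"
    using summable_if_null summable_sums by blast
  have "absv (fps_value (regroup c P) z - S) \<le> e" if e: "0 < e" for e
  proof -
    obtain N where N: "\<And>n. n \<ge> N \<Longrightarrow> absv (c n) < e"
      using c e unfolding null_seq_iff by blast
    define f where "f = (\<Sum>n<N. smult (c n) (P n))"
    have small: "absv (c n * b) \<le> e" if "n \<ge> N" "absv b \<le> 1" for n b
      using N[OF that(1)] absv_mult_le_left[OF that(2), of "c n"] by linarith
    have "absv (S - (\<Sum>n<N. c n * poly (P n) z)) \<le> e"
      using P z e by (intro absv_sums_tail_le[OF S] small absv_poly_le) (simp_all add: integral_poly_def)
    then have 1: "absv (poly f z - S) \<le> e"
      by (simp add: f_def poly_sum absv_minus_commute)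
    have coeffs: "absv (fps_nth (regroup c P) m - coeff f m) \<le> e" for m
      using absv_sums_tail_le[OF coeff_sums[of m], of N e] P e small
      by (simp add: integral_poly_def f_def coeff_sum)
    have "(\<lambda>m. fps_nth (regroup c P) m * z ^ m - coeff f m * z ^ m) sums
          (fps_value (regroup c P) z - poly f z)"
      by (intro sums_diff_ultra fps_value_sums regroup_null c P deg z poly_sums)
    then have 2: "absv (fps_value (regroup c P) z - poly f z) \<le> e"
    proof (rule absv_sums_le)
      fix m
      show "absv (fps_nth (regroup c P) m * z ^ m - coeff f m * z ^ m) \<le> e"
        using order_trans[OF absv_mult_power_le[OF z] coeffs] by (simp add: left_diff_distrib)
    qed
    show ?thesis using absv_add_leI[OF 2 1] by simp
  qed
  then have "absv (fps_value (regroup c P) z - S) \<le> 0"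
    using dense_ge by blast
  then have "absv (fps_value (regroup c P) z - S) = 0"
    by (intro order_antisym) simp_all
  then show ?thesis using S by simp
qed

text \<open>
  The matrix of coefficients of the \<open>P\<^sub>n\<close> is integral and triangular with 1 on the diagonal. In the
  \<open>d\<close>-th coefficient the term \<open>c\<^sub>d\<close> dominates, and the coefficients beyond \<open>d\<close> only involve \<open>c\<^sub>n\<close> with
  \<open>n > d\<close>.
\<close>

lemma regroup_weierstrass_degree:
  assumes c: "c \<longlonglongrightarrow> (0::'a)" and P: "\<And>n. integral_poly (P n)" and deg: "\<And>n. degree (P n) \<le> n"
    and monic: "\<And>n. coeff (P n) n = 1" and d: "weierstrass_degree c d"
  shows "weierstrass_degree (fps_nth (regroup c P)) d"
proof -
  note sums = regroup_sums[OF c P]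
  have nz: "c d \<noteq> 0" and le: "\<And>n. absv (c n) \<le> absv (c d)"
    and less: "\<And>n. n > d \<Longrightarrow> absv (c n) < absv (c d)"
    using d by (auto simp: weierstrass_degree_def)
  have bound: "absv (c n * coeff (P n) m) \<le> absv (c n)" for n m
    using P by (intro absv_mult_le_left) (simp add: integral_poly_def)
  have high: "absv (c n * coeff (P n) m) < absv (c d)" if "n < m \<or> d < n" for n m
  proof (cases "n < m")
    case True
    then have "coeff (P n) m = 0" by (intro coeff_eq_0 le_less_trans[OF deg])
    then show ?thesis using nz by simp
  qed (use that bound[of n m] less[of n] in auto)
  have "absv (fps_nth (regroup c P) d) = absv (c d * coeff (P d) d)"
    by (rule absv_sums_dominant[OF sums]) (use high[of _ d] nz monic in \<open>auto simp: neq_iff\<close>)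
  then have top: "absv (fps_nth (regroup c P) d) = absv (c d)"
    by (simp add: monic)
  show ?thesis
    unfolding weierstrass_degree_def top
  proof (intro conjI allI impI)
    show "fps_nth (regroup c P) d \<noteq> 0" using top nz by (metis absv_zero_iff)
    show "absv (fps_nth (regroup c P) m) \<le> absv (c d)" for m
      by (rule absv_sums_le[OF sums order_trans[OF bound le]])
    show "absv (fps_nth (regroup c P) m) < absv (c d)" if "d < m" for m
      by (rule absv_sums_less[OF sums high]) (use that in auto)
  qed
qed

context
  fixes F :: "'a fps" and x :: 'a
  assumes F: "fps_nth F \<longlonglongrightarrow> 0" and x: "absv x \<le> 1"
begin

lemma linear_quotient_sums:
  "(\<lambda>k. fps_nth F (Suc n + k) * x ^ k) sums fps_nth (linear_quotient F x) n"
proof -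
  have "(\<lambda>k. fps_nth F (k + Suc n)) \<longlonglongrightarrow> 0" by (rule LIMSEQ_ignore_initial_segment[OF F])
  then have "summable (\<lambda>k. fps_nth F (k + Suc n) * x ^ k)"
    by (intro summable_if_null null_mult_power x)
  then show ?thesis
    unfolding linear_quotient_def by (simp add: summable_sums add.commute)
qed

lemma linear_quotient_le:
  assumes "\<And>k. k > n \<Longrightarrow> absv (fps_nth F k) \<le> B"
  shows "absv (fps_nth (linear_quotient F x) n) \<le> B"
  by (rule absv_sums_le[OF linear_quotient_sums order_trans[OF absv_mult_power_le[OF x] assms]]) simp

lemma linear_quotient_less:
  assumes "\<And>k. k > n \<Longrightarrow> absv (fps_nth F k) < B"
  shows "absv (fps_nth (linear_quotient F x) n) < B"
  by (rule absv_sums_less[OF linear_quotient_sums le_less_trans[OF absv_mult_power_le[OF x] assms]]) simp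

lemma linear_quotient_null: "fps_nth (linear_quotient F x) \<longlonglongrightarrow> 0"
  unfolding null_seq_iff
proof (intro allI impI)
  fix e :: real assume "0 < e"
  then obtain N where "\<And>n. n \<ge> N \<Longrightarrow> absv (fps_nth F n) < e"
    using F unfolding null_seq_iff by blast
  then have "\<forall>n\<ge>N. absv (fps_nth (linear_quotient F x) n) < e"
    by (intro allI impI linear_quotient_less) simp
  then show "\<exists>N. \<forall>n\<ge>N. absv (fps_nth (linear_quotient F x) n) < e" ..
qed

lemma nth_linear_quotient_rec:
  "fps_nth (linear_quotient F x) n =
     fps_nth F (Suc n) + x * fps_nth (linear_quotient F x) (Suc n)"
proof (rule sums_unique2[OF linear_quotient_sums])
  have "(\<lambda>k. fps_nth F (Suc n + Suc k) * x ^ Suc k) sums (x * fps_nth (linear_quotient F x) (Suc n))"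
    using sums_mult_ultra[OF linear_quotient_sums, of x "Suc n"] by (simp add: mult_ac)
  from sums_Suc_ultra[OF this]
  show "(\<lambda>k. fps_nth F (Suc n + k) * x ^ k) sums
        (fps_nth F (Suc n) + x * fps_nth (linear_quotient F x) (Suc n))" by simp
qed

lemma nth_0_linear_quotient: "fps_nth F 0 = fps_value F x - x * fps_nth (linear_quotient F x) 0"
proof -
  have "(\<lambda>k. fps_nth F (Suc k) * x ^ Suc k) sums (x * fps_nth (linear_quotient F x) 0)"
    using sums_mult_ultra[OF linear_quotient_sums, of x 0] by (simp add: mult_ac)
  from sums_unique2[OF sums_Suc_ultra[OF this] fps_value_sums[OF F x]]
  show ?thesis by (auto simp: algebra_simps)
qed

lemma fps_value_linear_quotient:
  assumes y: "absv y \<le> 1"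
  shows "fps_value F y = fps_value F x + (y - x) * fps_value (linear_quotient F x) y"
proof -
  let ?B = "linear_quotient F x"
  have B: "(\<lambda>n. fps_nth ?B n * y ^ n) sums fps_value ?B y"
    by (rule fps_value_sums[OF linear_quotient_null y])
  then have "(\<lambda>n. fps_nth ?B (Suc n) * y ^ Suc n) sums (fps_value ?B y - fps_nth ?B 0)"
    by (subst sums_Suc_iff_ultra) simp
  then have "(\<lambda>n. y * (fps_nth ?B n * y ^ n) - x * (fps_nth ?B (Suc n) * y ^ Suc n)) sums
             (y * fps_value ?B y - x * (fps_value ?B y - fps_nth ?B 0))"
    by (intro sums_diff_ultra sums_mult_ultra B)
  moreover have "y * (fps_nth ?B n * y ^ n) - x * (fps_nth ?B (Suc n) * y ^ Suc n) =
                 fps_nth F (Suc n) * y ^ Suc n" for n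
    by (subst nth_linear_quotient_rec) (simp add: algebra_simps)
  ultimately have "(\<lambda>n. fps_nth F (Suc n) * y ^ Suc n) sums
             (y * fps_value ?B y - x * (fps_value ?B y - fps_nth ?B 0))"
    by simp
  from sums_unique2[OF sums_Suc_ultra[OF this] fps_value_sums[OF F y]]
  show ?thesis by (simp add: nth_0_linear_quotient algebra_simps)
qed

text \<open>
  The \<open>d\<close>-th coefficient of the quotient is \<open>F\<^bsub>d+1\<^esub> + F\<^bsub>d+2\<^esub> x + \<dots>\<close>, in which the first term
  dominates; later coefficients involve only smaller terms.
\<close>

lemma linear_quotient_weierstrass_degree:
  assumes d: "weierstrass_degree (fps_nth F) (Suc d)"
  shows "weierstrass_degree (fps_nth (linear_quotient F x)) d"
proof -
  have nz: "fps_nth F (Suc d) \<noteq> 0" and le: "\<And>n. absv (fps_nth F n) \<le> absv (fps_nth F (Suc d))"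
    and less: "\<And>n. n > Suc d \<Longrightarrow> absv (fps_nth F n) < absv (fps_nth F (Suc d))"
    using d by (auto simp: weierstrass_degree_def)
  have "absv (fps_nth (linear_quotient F x) d) = absv (fps_nth F (Suc d + 0) * x ^ 0)"
  proof (rule absv_sums_dominant[OF linear_quotient_sums])
    fix k :: nat assume "k \<noteq> 0"
    then show "absv (fps_nth F (Suc d + k) * x ^ k) < absv (fps_nth F (Suc d + 0) * x ^ 0)"
      using le_less_trans[OF absv_mult_power_le[OF x] less[of "Suc d + k"]] by simp
  qed (use nz in simp)
  then have top: "absv (fps_nth (linear_quotient F x) d) = absv (fps_nth F (Suc d))"
    by simp
  show ?thesis
    unfolding weierstrass_degree_def top
  proof (intro conjI allI impI)
    show "fps_nth (linear_quotient F x) d \<noteq> 0" using top nz by (metis absv_zero_iff)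
    show "absv (fps_nth (linear_quotient F x) n) < absv (fps_nth F (Suc d))" if "d < n" for n
      using that by (intro linear_quotient_less less) simp
  qed (intro linear_quotient_le le)
qed

end

text \<open>
  The difference is \<open>y - x\<close> times a value of the linear quotient, whose coefficients obey the same
  bound. This continuity is needed for the limit of a sequence of approximate zeros to be a zero.
\<close>

lemma absv_fps_value_diff_le:
  assumes "fps_nth F \<longlonglongrightarrow> (0::'a)" "absv x \<le> 1" "absv y \<le> 1" "\<And>n. absv (fps_nth F n) \<le> B"
  shows "absv (fps_value F y - fps_value F x) \<le> B * absv (y - x)"
proof -
  have "absv (fps_value (linear_quotient F x) y) \<le> B"
    using assms by (intro absv_fps_value_le linear_quotient_null linear_quotient_le)
  then have "absv (y - x) * absv (fps_value (linear_quotient F x) y) \<le> absv (y - x) * B"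
    by (rule mult_left_mono) simp
  then show ?thesis
    using fps_value_linear_quotient[OF assms(1-3)] by (simp add: absv_mult mult.commute)
qed

lemma fps_value_nonzero_if_degree_0:
  assumes F: "fps_nth F \<longlonglongrightarrow> (0::'a)" and d: "weierstrass_degree (fps_nth F) 0" and x: "absv x \<le> 1"
  shows "fps_value F x \<noteq> 0"
proof -
  have "absv (fps_value F x) = absv (fps_nth F 0 * x ^ 0)"
  proof (rule absv_sums_dominant[OF fps_value_sums[OF F x]])
    fix n :: nat assume "n \<noteq> 0"
    then show "absv (fps_nth F n * x ^ n) < absv (fps_nth F 0 * x ^ 0)"
      using d le_less_trans[OF absv_mult_power_le[OF x]] by (simp add: weierstrass_degree_def)
  qed (use d in \<open>simp add: weierstrass_degree_def\<close>)
  then show ?thesis using d by (auto simp: weierstrass_degree_def)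
qed

end

section \<open>Split polynomials\<close>

definition split_poly :: "'a::field \<Rightarrow> 'a list \<Rightarrow> 'a poly" where
  "split_poly c rs = smult c (\<Prod>r\<leftarrow>rs. [:- r, 1:])"

lemma split_poly_Nil: "split_poly c [] = [:c:]"
  by (simp add: split_poly_def)

lemma split_poly_Cons: "split_poly c (r # rs) = [:- r, 1:] * split_poly c rs"
  by (simp add: split_poly_def)

lemma poly_split_poly_root: "r \<in> set rs \<Longrightarrow> poly (split_poly c rs) r = 0"
  by (induction rs) (auto simp: split_poly_Cons)

lemma coeff_linear_times:
  "coeff ([:- r, 1:] * f) n = (case n of 0 \<Rightarrow> 0 | Suc m \<Rightarrow> coeff f m) - r * coeff f (n::nat)" for r :: "'a::field"
  by (simp add: coeff_pCons split: nat.split)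

lemma weierstrass_degree_unique:
  "weierstrass_degree c d \<Longrightarrow> weierstrass_degree c e \<Longrightarrow> d = e"
  unfolding weierstrass_degree_def by (metis leD linorder_neqE_nat)

context ultrametric_field
begin

lemma weierstrass_degree_perturb:
  assumes d: "weierstrass_degree (c :: nat \<Rightarrow> 'a) d" and less: "\<And>n. absv (c n - b n) < absv (c d)"
  shows "weierstrass_degree b d" and "absv (b d) = absv (c d)"
proof -
  show top: "absv (b d) = absv (c d)"
    using absv_add_eq_left[of "b d - c d" "c d"] less[of d] by (simp add: absv_minus_commute)
  have "absv (b n) \<le> absv (c d)" for n
    using absv_diff_leI[of "c n" "absv (c d)" "c n - b n"] d less[of n]
    by (simp add: weierstrass_degree_def)
  moreover have "absv (b n) < absv (c d)" if "n > d" for n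
    using absv_diff_lessI[of "c n" "absv (c d)" "c n - b n"] d less[of n] that
    by (simp add: weierstrass_degree_def)
  moreover have "b d \<noteq> 0" using top d by (auto simp: weierstrass_degree_def)
  ultimately show "weierstrass_degree b d" by (simp add: weierstrass_degree_def top)
qed

text \<open>
  Multiplying by \<open>X - r\<close> raises the degree by one if \<open>r\<close> lies in the unit ball, and otherwise only
  scales by \<open>|r|\<close>. Hence the degree of a split polynomial is the number of its roots in the unit ball.
\<close>

lemma weierstrass_degree_times_small_root:
  assumes d: "weierstrass_degree (coeff f) d" and r: "absv (r::'a) \<le> 1"
  shows "absv (coeff ([:- r, 1:] * f) (Suc d)) = absv (coeff f d)"
    and "weierstrass_degree (coeff ([:- r, 1:] * f)) (Suc d)"
proof -
  have nz: "coeff f d \<noteq> 0" and le: "\<And>n. absv (coeff f n) \<le> absv (coeff f d)"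
    and less: "\<And>n. n > d \<Longrightarrow> absv (coeff f n) < absv (coeff f d)"
    using d by (auto simp: weierstrass_degree_def)
  have r_le: "absv (r * coeff f n) \<le> absv (coeff f n)" for n
    using absv_mult_le_left[OF r, of "coeff f n"] by (simp add: mult.commute)
  have "absv (coeff f d + - (r * coeff f (Suc d))) = absv (coeff f d)"
    by (rule absv_add_eq_left) (use le_less_trans[OF r_le less] in simp)
  then show top: "absv (coeff ([:- r, 1:] * f) (Suc d)) = absv (coeff f d)"
    by (simp add: coeff_linear_times del: mult_pCons_left)
  show "weierstrass_degree (coeff ([:- r, 1:] * f)) (Suc d)"
    unfolding weierstrass_degree_def top
  proof (intro conjI allI impI)
    show "coeff ([:- r, 1:] * f) (Suc d) \<noteq> 0" using top nz by (metis absv_zero_iff)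
    show "absv (coeff ([:- r, 1:] * f) n) \<le> absv (coeff f d)" for n
      unfolding coeff_linear_times
      by (intro absv_diff_leI order_trans[OF r_le le]) (simp add: le split: nat.split)
    show "absv (coeff ([:- r, 1:] * f) n) < absv (coeff f d)" if "Suc d < n" for n
      unfolding coeff_linear_times
      by (intro absv_diff_lessI le_less_trans[OF r_le less])
         (use that in \<open>auto intro: less split: nat.split\<close>)
  qed
qed

lemma weierstrass_degree_times_large_root:
  assumes d: "weierstrass_degree (coeff f) d" and r: "absv (r::'a) > 1"
  shows "absv (coeff ([:- r, 1:] * f) d) = absv r * absv (coeff f d)"
    and "weierstrass_degree (coeff ([:- r, 1:] * f)) d"
proof -
  have nz: "coeff f d \<noteq> 0" and le: "\<And>n. absv (coeff f n) \<le> absv (coeff f d)"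
    and less: "\<And>n. n > d \<Longrightarrow> absv (coeff f n) < absv (coeff f d)"
    using d by (auto simp: weierstrass_degree_def)
  have pos: "0 < absv (coeff f d)" using nz by simp
  have shift: "absv (case n of 0 \<Rightarrow> 0 | Suc m \<Rightarrow> coeff f m) < absv r * absv (coeff f d)" for n
  proof -
    have "absv (coeff f m) < absv r * absv (coeff f d)" for m
      using le[of m] mult_strict_right_mono[OF r pos] by linarith
    moreover have "0 < absv r * absv (coeff f d)" using r pos by (intro mult_pos_pos) linarith+
    ultimately show ?thesis by (simp split: nat.split)
  qed
  have "absv (- (r * coeff f d) + (case d of 0 \<Rightarrow> 0 | Suc m \<Rightarrow> coeff f m)) = absv (- (r * coeff f d))"
    by (rule absv_add_eq_left) (use shift[of d] in \<open>simp add: absv_mult\<close>)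
  then show top: "absv (coeff ([:- r, 1:] * f) d) = absv r * absv (coeff f d)"
    unfolding coeff_linear_times by (simp add: absv_mult)
  show "weierstrass_degree (coeff ([:- r, 1:] * f)) d"
    unfolding weierstrass_degree_def top
  proof (intro conjI allI impI)
    have "absv (coeff ([:- r, 1:] * f) d) \<noteq> 0" unfolding top using r pos by (metis mult_eq_0_iff less_irrefl not_one_less_zero)
    then show "coeff ([:- r, 1:] * f) d \<noteq> 0" by (metis absv_zero_iff)
    show "absv (coeff ([:- r, 1:] * f) n) \<le> absv r * absv (coeff f d)" for n
      unfolding coeff_linear_times
      by (intro absv_diff_leI less_imp_le[OF shift]) (simp add: absv_mult le mult_left_mono)
    show "absv (coeff ([:- r, 1:] * f) n) < absv r * absv (coeff f d)" if "d < n" for n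
      unfolding coeff_linear_times
      by (intro absv_diff_lessI shift)
         (use that r in \<open>auto simp: absv_mult intro!: mult_strict_left_mono less\<close>)
  qed
qed

lemma split_poly_weierstrass_degree:
  assumes c: "(c::'a) \<noteq> 0"
  shows "weierstrass_degree (coeff (split_poly c rs)) (length (filter (\<lambda>r. absv r \<le> 1) rs))"
proof (induction rs)
  case Nil
  then show ?case using c by (simp add: weierstrass_degree_def split_poly_Nil coeff_pCons split: nat.split)
next
  case (Cons r rs)
  then show ?case
    using weierstrass_degree_times_small_root(2) weierstrass_degree_times_large_root(2)
    by (simp add: split_poly_Cons del: mult_pCons_left)
qed

text \<open>
  A factor \<open>y - r\<close> with \<open>r\<close> outside the unit ball has absolute value \<open>|r|\<close>, the same factor by which
  \<open>X - r\<close> scales the leading absolute value; each of the other factors contributes at least \<open>\<delta>\<close>. So a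
  small value at \<open>y\<close> forces a root close to \<open>y\<close>.
\<close>

lemma split_poly_lower_bound:
  fixes y :: 'a and \<delta> :: real
  defines "k \<equiv> \<lambda>rs::'a list. length (filter (\<lambda>r. absv r \<le> 1) rs)"
  assumes c: "c \<noteq> 0" and y: "absv y \<le> 1" and \<delta>: "0 \<le> \<delta>"
    and far: "\<And>r. r \<in> set rs \<Longrightarrow> absv r \<le> 1 \<Longrightarrow> \<delta> \<le> absv (y - r)"
  shows "absv (coeff (split_poly c rs) (k rs)) * \<delta> ^ k rs \<le> absv (poly (split_poly c rs) y)"
  using far
proof (induction rs)
  case Nil
  then show ?case by (simp add: k_def split_poly_Nil)
next
  case (Cons r rs)
  let ?f = "split_poly c rs"
  have IH: "absv (coeff ?f (k rs)) * \<delta> ^ k rs \<le> absv (poly ?f y)"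
    using Cons by simp
  have wd: "weierstrass_degree (coeff ?f) (k rs)"
    unfolding k_def by (rule split_poly_weierstrass_degree[OF c])
  have val: "absv (poly (split_poly c (r # rs)) y) = absv (y - r) * absv (poly ?f y)"
    by (simp add: split_poly_Cons absv_mult left_diff_distrib flip: absv_mult)
  show ?case
  proof (cases "absv r \<le> 1")
    case True
    then have "k (r # rs) = Suc (k rs)" by (simp add: k_def)
    then have "absv (coeff (split_poly c (r # rs)) (k (r # rs))) * \<delta> ^ k (r # rs) =
               \<delta> * (absv (coeff ?f (k rs)) * \<delta> ^ k rs)"
      using weierstrass_degree_times_small_root(1)[OF wd True]
      by (simp add: split_poly_Cons del: mult_pCons_left)
    also have "\<dots> \<le> absv (y - r) * absv (poly ?f y)"
      using Cons.prems[of r] True IH \<delta> by (intro mult_mono) auto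
    finally show ?thesis by (simp add: val)
  next
    case False
    then have "k (r # rs) = k rs" by (simp add: k_def)
    then have "absv (coeff (split_poly c (r # rs)) (k (r # rs))) * \<delta> ^ k (r # rs) =
               absv r * (absv (coeff ?f (k rs)) * \<delta> ^ k rs)"
      using weierstrass_degree_times_large_root(1)[OF wd, of r] False
      by (simp add: split_poly_Cons del: mult_pCons_left)
    also have "\<dots> \<le> absv r * absv (poly ?f y)"
      using IH by (intro mult_left_mono) auto
    also have "absv r = absv (y - r)"
      using absv_add_eq_left[of y "- r"] y False by simp
    finally show ?thesis by (simp add: val)
  qed
qed

end

section \<open>Existence of zeros\<close>

text \<open>
  In the intended instance \<open>A\<close> is the algebraic closure of the p-adic numbers inside its completion.
  The set \<open>A\<close> only serves as a supply of coefficients: whenever a root has been split off, the quotient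
  is approximated by a polynomial over \<open>A\<close> anew.
\<close>

locale dense_root_field = ultrametric_field K
  for K :: "'a::{field_char_0, complete_space} itself" +
  fixes A :: "'a set"
  assumes dense: "closure A = UNIV"
    and zero_mem: "0 \<in> A"
    and has_root: "\<And>f. degree f > 0 \<Longrightarrow> (\<And>i. coeff f i \<in> A) \<Longrightarrow> \<exists>x. poly f x = 0"
begin

text \<open>
  A perturbation of \<open>f\<close> with coefficients in \<open>A\<close> has a root \<open>r\<close>. The perturbation is kept below the
  absolute value of the leading coefficient so that the degree does not drop.
\<close>

lemma approximate_with_root:
  fixes f :: "'a poly"
  assumes f: "degree f > 0" and e: "0 < e"
  obtains h r where "\<And>i. absv (coeff (f - ([:- r, 1:] * h)) i) < e" "degree h < degree f"
proof -
  define e' where "e' = min e (absv (lead_coeff f))"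
  have "0 < e'" using e f by (auto simp: e'_def)
  then have "\<exists>b\<in>A. dist b (coeff f i) < e'" for i
    using dense by (metis UNIV_I closure_approachable)
  then obtain a where a: "\<And>i. a i \<in> A" "\<And>i. dist (a i) (coeff f i) < e'"
    by metis
  define k where "k = (\<Sum>i\<le>degree f. monom (a i) i)"
  have coeff_k: "coeff k i = (if i \<le> degree f then a i else 0)" for i
    by (simp add: k_def coeff_sum)
  have close: "absv (coeff (f - k) i) < e'" for i
    using a(2)[of i] \<open>0 < e'\<close>
    by (auto simp: coeff_k dist_absv absv_minus_commute coeff_eq_0)
  have "a (degree f) \<noteq> 0"
    using a(2)[of "degree f"] by (auto simp: dist_absv e'_def)
  then have deg_k: "degree k = degree f"
    by (intro order_antisym degree_le le_degree) (auto simp: coeff_k)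
  obtain r where "poly k r = 0"
    using has_root[of k] deg_k f a(1) zero_mem by (metis coeff_k)
  then obtain h where h: "k = [:- r, 1:] * h"
    by (metis dvdE poly_eq_0_iff_dvd)
  then have "h \<noteq> 0" using deg_k f by auto
  then have "degree k = Suc (degree h)"
    unfolding h by (subst degree_mult_eq) auto
  then show ?thesis
    using that[of r h] close deg_k h by (simp add: e'_def)
qed

text \<open>
  After splitting off one root by \<open>approximate_with_root\<close>, the quotient, whose coefficients need not lie
  in \<open>A\<close>, is approximated by induction on the degree.
\<close>

lemma split_polys_dense:
  fixes f :: "'a poly"
  assumes "0 < e"
  obtains c rs where "\<And>i. absv (coeff (f - split_poly c rs) i) < e"
proof -
  have "\<exists>c rs. \<forall>i. absv (coeff (f - split_poly c rs) i) < e" if "0 < e" for e and f :: "'a poly"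
    using that
  proof (induction "degree f" arbitrary: f e rule: less_induct)
    case less
    show ?case
    proof (cases "degree f = 0")
      case True
      then obtain c where "f = [:c:]" by (rule degree_eq_zeroE)
      then have "\<forall>i. absv (coeff (f - split_poly c []) i) < e"
        using less.prems by (simp add: split_poly_Nil)
      then show ?thesis by blast
    next
      case False
      then obtain h r where f: "\<And>i. absv (coeff (f - ([:- r, 1:] * h)) i) < e"
        and deg: "degree h < degree f"
        using approximate_with_root[of f e] less.prems by blast
      \<comment> \<open>Multiplication by \<open>X - r\<close> enlarges coefficients at most by the factor \<open>M\<close>.\<close>
      define M where "M = max 1 (absv r)"
      have M: "1 \<le> M" "absv r \<le> M" by (simp_all add: M_def)
      then have "0 < e / M" using less.prems by simp
      from less.hyps[OF deg this] obtain c rs where h: "\<And>i. absv (coeff (h - split_poly c rs) i) < e / M"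
        by blast
      have times: "absv (b * coeff (h - split_poly c rs) i) < e" if "absv b \<le> M" for b i
      proof -
        have "absv (b * coeff (h - split_poly c rs) i) \<le> M * absv (coeff (h - split_poly c rs) i)"
          using that by (simp add: absv_mult mult_right_mono del: coeff_diff)
        also have "\<dots> < M * (e / M)" using h M by (intro mult_strict_left_mono) auto
        finally show ?thesis using M by simp
      qed
      have "absv (coeff ([:- r, 1:] * (h - split_poly c rs)) i) < e" for i
        unfolding coeff_linear_times
        using times[of 1] times[of r] M less.prems
        by (intro absv_diff_lessI) (simp_all del: coeff_diff split: nat.split)
      then have "absv (coeff (f - [:- r, 1:] * h) i + coeff ([:- r, 1:] * (h - split_poly c rs)) i) < e" for i
        using f by (intro absv_add_lessI)
      moreover have "coeff (f - [:- r, 1:] * h) i + coeff ([:- r, 1:] * (h - split_poly c rs)) i =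
                     coeff (f - split_poly c (r # rs)) i" for i
        unfolding split_poly_Cons right_diff_distrib coeff_diff by (simp del: mult_pCons_left)
      ultimately show ?thesis by metis
    qed
  qed
  then show ?thesis using assms that by metis
qed

text \<open>
  One step of an iteration in the style of Newton. The series is replaced by a split polynomial \<open>s\<close> so
  close to it that \<open>s\<close> has the same degree, hence \<open>d > 0\<close> roots in the unit ball; \<open>r\<close> is the one of these
  nearest to \<open>y\<close>. The series is small at \<open>r\<close> because \<open>s\<close> vanishes there.
\<close>

lemma approximate_zero_step:
  assumes F: "fps_nth F \<longlonglongrightarrow> (0::'a)" and d: "weierstrass_degree (fps_nth F) d" "0 < d"
    and y: "absv y \<le> 1" and \<eta>: "0 < \<eta>"
  obtains r where "absv r \<le> 1" "absv (fps_nth F d) * absv (y - r) ^ d \<le> max (absv (fps_value F y)) \<eta>"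
    "absv (fps_value F r) \<le> \<eta>"
proof -
  \<comment> \<open>Coefficients within \<open>|F\<^sub>d|\<close> of those of \<open>F\<close> give the same Weierstrass degree.\<close>
  define e where "e = min \<eta> (absv (fps_nth F d))"
  have e: "0 < e" "e \<le> \<eta>" "e \<le> absv (fps_nth F d)"
    using \<eta> d by (auto simp: e_def weierstrass_degree_def)
  obtain N where N: "\<And>n. n \<ge> N \<Longrightarrow> absv (fps_nth F n) < e"
    using F e(1) unfolding null_seq_iff by blast
  define f where "f = (\<Sum>i<N. monom (fps_nth F i) i)"
  have coeff_f: "coeff f i = (if i < N then fps_nth F i else 0)" for i
    by (simp add: f_def coeff_sum)
  obtain c rs where cs: "\<And>i. absv (coeff (f - split_poly c rs) i) < e"
    using split_polys_dense[OF e(1)] by blast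
  define s where "s = split_poly c rs"
  have close: "absv (fps_nth F i - coeff s i) < e" for i
    using absv_add_lessI[of "fps_nth F i - coeff f i" e "coeff (f - s) i"] N[of i] cs[of i] e(1)
    by (auto simp: coeff_f s_def)
  have wd: "weierstrass_degree (coeff s) d" and top: "absv (coeff s d) = absv (fps_nth F d)"
    using weierstrass_degree_perturb[OF d(1), of "coeff s"] close e(3) by (meson less_le_trans)+
  have "c \<noteq> 0" using wd by (auto simp: weierstrass_degree_def s_def split_poly_def)
  then have len: "length (filter (\<lambda>r. absv r \<le> 1) rs) = d"
    using weierstrass_degree_unique[OF split_poly_weierstrass_degree wd[unfolded s_def]] by simp
  define S where "S = {r \<in> set rs. absv r \<le> 1}"
  have "S \<noteq> {}" "finite S"
    using len d(2) by (auto simp: S_def simp flip: set_filter)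
  then obtain r where r: "r \<in> S" and r_min: "\<And>t. t \<in> S \<Longrightarrow> absv (y - r) \<le> absv (y - t)"
    using ex_min_if_finite[of "(\<lambda>r. absv (y - r)) ` S"] by (auto simp: not_less)
  have value_close: "absv (fps_value F z - poly s z) \<le> e" if z: "absv z \<le> 1" for z
  proof (rule absv_sums_le)
    show "(\<lambda>n. fps_nth F n * z ^ n - coeff s n * z ^ n) sums (fps_value F z - poly s z)"
      by (intro sums_diff_ultra fps_value_sums F z poly_sums)
    show "absv (fps_nth F n * z ^ n - coeff s n * z ^ n) \<le> e" for n
      using absv_mult_power_le[OF z, of "fps_nth F n - coeff s n" n] close[of n]
      by (simp add: left_diff_distrib)
  qed
  have "absv (coeff s d) * absv (y - r) ^ d \<le> absv (poly s y)"
    using split_poly_lower_bound[OF \<open>c \<noteq> 0\<close> y, of "absv (y - r)" rs] r_min len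
    by (simp add: S_def s_def)
  also have "\<dots> \<le> max (absv (fps_value F y)) \<eta>"
    using absv_diff_le[of "fps_value F y" "fps_value F y - poly s y"] value_close[OF y] e(2) by auto
  finally show ?thesis
    using that[of r] r value_close[of r] e(2) top
    by (auto simp: S_def s_def poly_split_poly_root)
qed

text \<open>
  Iterating \<open>approximate_zero_step\<close> with tolerances \<open>|F\<^sub>d| 2\<^bsup>-nd\<^esup>\<close> gives points whose distances are at
  most \<open>2\<^bsup>-n\<^esup>\<close> and at which the series tends to 0.
\<close>

lemma zero_exists:
  assumes F: "fps_nth F \<longlonglongrightarrow> (0::'a)" and d: "weierstrass_degree (fps_nth F) d" "0 < d"
  obtains x where "absv x \<le> 1" "fps_value F x = 0"
proof -
  define G where "G = absv (fps_nth F d)"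
  have G: "0 < G" and le_G: "\<And>n. absv (fps_nth F n) \<le> G"
    using d by (auto simp: G_def weierstrass_degree_def)
  define good where "good n x \<longleftrightarrow> absv x \<le> 1 \<and> absv (fps_value F x) \<le> G * ((1/2) ^ n) ^ d" for n x
  have start: "good 0 0"
    using absv_fps_value_le[OF F _ le_G, of 0] by (simp add: good_def)
  have step: "\<exists>y. good (Suc n) y \<and> absv (x - y) \<le> (1/2) ^ n" if x: "good n x" for n x
  proof -
    have "0 < G * ((1/2) ^ Suc n) ^ d" using G by simp
    then obtain y where y: "absv y \<le> 1" "absv (fps_value F y) \<le> G * ((1/2) ^ Suc n) ^ d"
      and near: "G * absv (x - y) ^ d \<le> max (absv (fps_value F x)) (G * ((1/2) ^ Suc n) ^ d)"
      using approximate_zero_step[OF F d, of x] x unfolding good_def G_def by blast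
    have "((1/2::real) ^ Suc n) ^ d \<le> ((1/2) ^ n) ^ d"
      by (intro power_mono power_decreasing) auto
    then have "G * ((1/2) ^ Suc n) ^ d \<le> G * ((1/2) ^ n) ^ d"
      using G by (intro mult_left_mono) auto
    then have "G * absv (x - y) ^ d \<le> G * ((1/2) ^ n) ^ d"
      using near x by (auto simp: good_def)
    then have "absv (x - y) ^ d \<le> ((1/2) ^ n) ^ d"
      using G by simp
    then have "absv (x - y) \<le> (1/2) ^ n"
      using d(2) by (simp add: power_mono_iff)
    then show ?thesis using y by (auto simp: good_def)
  qed
  have "\<exists>X. \<forall>n. good n (X n) \<and> absv (X n - X (Suc n)) \<le> (1/2) ^ n"
    using start step by (intro dependent_nat_choice) blast+
  then obtain X where X: "\<And>n. good n (X n)" and steps: "\<And>n. absv (X n - X (Suc n)) \<le> (1/2) ^ n"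
    by blast
  have "(\<lambda>n. X (Suc n) - X n) \<longlonglongrightarrow> 0"
  proof (rule null_seq_iff_absv[THEN iffD2], rule Lim_null_comparison)
    show "\<forall>\<^sub>F n in sequentially. norm (absv (X (Suc n) - X n)) \<le> (1/2) ^ n"
      using steps by (simp add: absv_minus_commute)
    show "(\<lambda>n. (1/2::real) ^ n) \<longlonglongrightarrow> 0" by (rule LIMSEQ_power_zero) simp
  qed
  then obtain x where x: "X \<longlonglongrightarrow> x"
    using convergent_if_steps_null by (auto simp: convergent_def)
  have x_le: "absv x \<le> 1" by (rule absv_lim_le[OF x]) (use X in \<open>simp add: good_def\<close>)
  have bound: "absv (fps_value F x) \<le> G * dist (X n) x + G * (1/2) ^ n" for n
  proof -
    have "absv (fps_value F (X n) - fps_value F x) \<le> G * absv (X n - x)"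
      using X x_le by (intro absv_fps_value_diff_le F le_G) (auto simp: good_def)
    moreover have "absv (fps_value F (X n)) \<le> G * (1/2) ^ n"
    proof -
      have "((1/2::real) ^ n) ^ d \<le> ((1/2) ^ n) ^ 1"
        using d(2) by (intro power_decreasing) (auto simp: power_le_one)
      then have "G * ((1/2) ^ n) ^ d \<le> G * (1/2) ^ n"
        using G by simp
      then show ?thesis using X[of n] by (auto simp: good_def)
    qed
    moreover have "absv (fps_value F x) \<le>
        max (absv (fps_value F (X n))) (absv (fps_value F (X n) - fps_value F x))"
      using absv_diff_le[of "fps_value F (X n)" "fps_value F (X n) - fps_value F x"] by simp
    ultimately show ?thesis
      using absv_nonneg[of "fps_value F (X n)"] absv_nonneg[of "fps_value F (X n) - fps_value F x"]
      unfolding dist_absv by linarith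
  qed
  have "(\<lambda>n. dist (X n) x) \<longlonglongrightarrow> 0"
    using x by (rule tendsto_dist_iff[THEN iffD1])
  then have "(\<lambda>n. G * dist (X n) x + G * (1/2) ^ n) \<longlonglongrightarrow> G * 0 + G * 0"
    by (intro tendsto_add tendsto_mult_left LIMSEQ_power_zero) simp_all
  then have "absv (fps_value F x) \<le> 0"
    using bound by (intro LIMSEQ_le_const) auto
  then have "absv (fps_value F x) = 0" by (intro order_antisym) simp_all
  then have "fps_value F x = 0" by simp
  then show ?thesis using x_le that by blast
qed

end

section \<open>Vanishing orders and the number of zeros\<close>

context ultrametric_field
begin

lemma has_power_series_at_iff:
  "has_power_series_at f F (x::'a) \<longleftrightarrow>
     (\<exists>r>0. \<forall>z. absv z < r \<longrightarrow> (\<lambda>n. fps_nth F n * z ^ n) sums f (x + z))"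
proof -
  have "(\<forall>y\<in>ball x r. (\<lambda>n. fps_nth F n * (y - x) ^ n) sums f y) \<longleftrightarrow>
        (\<forall>z. absv z < r \<longrightarrow> (\<lambda>n. fps_nth F n * z ^ n) sums f (x + z))" (is "?L \<longleftrightarrow> ?R") for r
  proof
    assume L: ?L
    show ?R
    proof (intro allI impI)
      fix z :: 'a assume "absv z < r"
      then have "x + z \<in> ball x r" by (simp add: dist_absv)
      from L[rule_format, OF this] show "(\<lambda>n. fps_nth F n * z ^ n) sums f (x + z)" by simp
    qed
  next
    assume R: ?R
    show ?L
    proof
      fix y assume "y \<in> ball x r"
      then have "absv (y - x) < r" by (simp add: dist_absv absv_minus_commute)
      from R[rule_format, OF this] show "(\<lambda>n. fps_nth F n * (y - x) ^ n) sums f y" by simp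
    qed
  qed
  then show ?thesis unfolding has_power_series_at_def by simp
qed

lemma power_small:
  assumes "0 < e"
  obtains \<pi> where "(\<pi>::'a) \<noteq> 0" "absv \<pi> < e" "absv \<pi> \<le> 1"
proof -
  obtain \<pi> :: 'a where \<pi>: "\<pi> \<noteq> 0" "absv \<pi> < 1" using nontrivial by blast
  obtain n where "absv \<pi> ^ n < e" using real_arch_pow_inv[OF assms \<pi>(2)] by blast
  then show ?thesis using that[of "\<pi> ^ n"] \<pi> by (simp add: absv_power power_le_one)
qed

text \<open>
  The identity theorem. At a point \<open>\<pi> w\<close> with \<open>\<pi>\<close> small enough, the lowest nonzero term would
  exceed all the later ones and could not cancel.
\<close>

lemma zero_series:
  assumes r: "0 < r" and sums: "\<And>z. absv z < r \<Longrightarrow> (\<lambda>n. fps_nth H n * z ^ n) sums (0::'a)"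
  shows "H = 0"
proof (rule ccontr)
  assume "H \<noteq> 0"
  define d where "d = subdegree H"
  have nz: "fps_nth H d \<noteq> 0" using \<open>H \<noteq> 0\<close> by (simp add: d_def)
  obtain w :: 'a where w: "w \<noteq> 0" "absv w < r" by (rule power_small[OF r]) blast
  have "(\<lambda>n. fps_nth H n * w ^ n) \<longlonglongrightarrow> 0"
    by (rule null_if_sums[OF sums[OF w(2)]])
  then have "Bseq (\<lambda>n. absv (fps_nth H n * w ^ n))"
    by (intro convergent_imp_Bseq convergentI[of _ 0]) (rule null_seq_iff_absv[THEN iffD1])
  then obtain B where B: "0 < B" "\<And>n. absv (fps_nth H n * w ^ n) \<le> B"
    by (auto simp: Bseq_def)
  define L where "L = absv (fps_nth H d * w ^ d)"
  have L: "0 < L" using nz w(1) by (simp add: L_def)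
  have "0 < L / B" using L B(1) by simp
  then obtain \<pi> :: 'a where \<pi>: "\<pi> \<noteq> 0" "absv \<pi> < L / B" "absv \<pi> \<le> 1" by (rule power_small)
  have "absv \<pi> * absv w \<le> absv w" using \<pi>(3) by (intro mult_left_le_one_le) simp_all
  then have small: "absv (\<pi> * w) < r" using w(2) by (simp add: absv_mult)
  have term_eq: "absv (fps_nth H n * (\<pi> * w) ^ n) = absv (fps_nth H n * w ^ n) * absv \<pi> ^ n" for n
    by (simp add: power_mult_distrib absv_mult absv_power mult_ac)
  have "absv (0::'a) = absv (fps_nth H d * (\<pi> * w) ^ d)"
  proof (rule absv_sums_dominant[OF sums[OF small]])
    show "fps_nth H d * (\<pi> * w) ^ d \<noteq> 0" using nz w(1) \<pi>(1) by simp
    fix n assume "n \<noteq> d"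
    show "absv (fps_nth H n * (\<pi> * w) ^ n) < absv (fps_nth H d * (\<pi> * w) ^ d)"
    proof (cases "n < d")
      case True
      then have "fps_nth H n = 0" unfolding d_def by (rule nth_less_subdegree_zero)
      then show ?thesis using nz w(1) \<pi>(1) by simp
    next
      case False
      then have "Suc d \<le> n" using \<open>n \<noteq> d\<close> by simp
      then have "absv \<pi> ^ n \<le> absv \<pi> ^ Suc d"
        using \<pi>(3) by (intro power_decreasing) auto
      then have "absv (fps_nth H n * w ^ n) * absv \<pi> ^ n \<le> B * absv \<pi> ^ Suc d"
        using B by (intro mult_mono) auto
      also have "\<dots> = (B * absv \<pi>) * absv \<pi> ^ d" by simp
      also have "\<dots> < L * absv \<pi> ^ d"
        using \<pi> B(1) by (intro mult_strict_right_mono) (auto simp: field_simps)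
      finally show ?thesis by (simp add: term_eq L_def)
    qed
  qed
  then show False using nz w(1) \<pi>(1) by (simp add: absv_mult absv_power)
qed

lemma has_power_series_at_unique:
  assumes "has_power_series_at f F (x::'a)" and "has_power_series_at f G x"
  shows "F = G"
proof -
  obtain r s where r: "0 < r" "\<And>z. absv z < r \<Longrightarrow> (\<lambda>n. fps_nth F n * z ^ n) sums f (x + z)"
    and s: "0 < s" "\<And>z. absv z < s \<Longrightarrow> (\<lambda>n. fps_nth G n * z ^ n) sums f (x + z)"
    using assms unfolding has_power_series_at_iff by blast
  have "F - G = 0"
  proof (rule zero_series)
    show "0 < min r s" using r s by simp
    fix z :: 'a assume "absv z < min r s"
    then show "(\<lambda>n. fps_nth (F - G) n * z ^ n) sums 0"
      using sums_diff_ultra[OF r(2) s(2), of z z] by (simp add: left_diff_distrib)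
  qed
  then show ?thesis by simp
qed

lemma vanishing_order_eq_subdegree:
  assumes "has_power_series_at f F (x::'a)" and "F \<noteq> 0"
  shows "vanishing_order f x = subdegree F"
  unfolding vanishing_order_def
  by (rule the_equality) (use assms has_power_series_at_unique in blast)+

lemma has_power_series_at_cong:
  assumes "has_power_series_at f F (x::'a)" and "0 < r"
    and "\<And>z. absv z < r \<Longrightarrow> f (x + z) = h (x + z)"
  shows "has_power_series_at h F x"
proof -
  obtain s where s: "0 < s" "\<And>z. absv z < s \<Longrightarrow> (\<lambda>n. fps_nth F n * z ^ n) sums f (x + z)"
    using assms(1) unfolding has_power_series_at_iff by blast
  then have "\<forall>z. absv z < min r s \<longrightarrow> (\<lambda>n. fps_nth F n * z ^ n) sums h (x + z)"
    by (simp flip: assms(3))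
  then show ?thesis
    unfolding has_power_series_at_iff using s(1) assms(2) by (meson min_less_iff_conj)
qed

lemma has_power_series_at_times_linear:
  assumes "has_power_series_at h B (x::'a)"
  shows "has_power_series_at (\<lambda>y. (y - a) * h y) ((fps_X + fps_const (x - a)) * B) x"
proof -
  obtain r where r: "0 < r" "\<And>z. absv z < r \<Longrightarrow> (\<lambda>n. fps_nth B n * z ^ n) sums h (x + z)"
    using assms unfolding has_power_series_at_iff by blast
  have "(\<lambda>n. fps_nth ((fps_X + fps_const (x - a)) * B) n * z ^ n) sums ((x + z - a) * h (x + z))"
    if z: "absv z < r" for z
  proof -
    have "(\<lambda>n. fps_nth (fps_X * B) (Suc n) * z ^ Suc n) sums (z * h (x + z))"
      using sums_mult_ultra[OF r(2)[OF z], of z] by (simp add: mult_ac)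
    from sums_Suc_ultra[OF this]
    have "(\<lambda>n. fps_nth (fps_X * B) n * z ^ n) sums (z * h (x + z))" by simp
    moreover have "(\<lambda>n. (x - a) * (fps_nth B n * z ^ n)) sums ((x - a) * h (x + z))"
      by (rule sums_mult_ultra[OF r(2)[OF z]])
    ultimately have "(\<lambda>n. fps_nth (fps_X * B) n * z ^ n + (x - a) * (fps_nth B n * z ^ n)) sums
        (z * h (x + z) + (x - a) * h (x + z))"
      by (rule sums_add_ultra)
    moreover have "fps_nth ((fps_X + fps_const (x - a)) * B) n * z ^ n =
        fps_nth (fps_X * B) n * z ^ n + (x - a) * (fps_nth B n * z ^ n)" for n
      by (simp only: distrib_right fps_add_nth fps_mult_left_const_nth mult.assoc)
    moreover have "z * h (x + z) + (x - a) * h (x + z) = (x + z - a) * h (x + z)"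
      by (simp add: algebra_simps)
    ultimately show ?thesis by simp
  qed
  then show ?thesis unfolding has_power_series_at_iff using r(1) by blast
qed

lemma has_power_series_at_nth_0:
  assumes "has_power_series_at f F (x::'a)"
  shows "fps_nth F 0 = f x"
proof -
  have "(\<lambda>n. fps_nth F n * 0 ^ n) sums f x"
    using assms unfolding has_power_series_at_iff by (metis absv_0 add.right_neutral)
  moreover have "(\<lambda>n. fps_nth F n * 0 ^ n) = (\<lambda>n. if n = 0 then fps_nth F n else 0)"
    by auto
  ultimately show ?thesis using sums_unique2[OF sums_single] by metis
qed

lemma vanishing_order_eq_0:
  assumes "has_power_series_at f F (x::'a)" and "f x \<noteq> 0"
  shows "vanishing_order f x = 0"
proof -
  have "fps_nth F 0 \<noteq> 0" using has_power_series_at_nth_0[OF assms(1)] assms(2) by simp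
  moreover from this have "F \<noteq> 0" by (metis fps_zero_nth)
  ultimately show ?thesis using vanishing_order_eq_subdegree[OF assms(1)] by simp
qed

text \<open>
  Moving the center to \<open>x\<close> within the unit ball gives a series that converges on the whole unit ball
  again. It is not zero, since otherwise the function would vanish on the unit ball, a neighbourhood
  of 0, and so would \<open>F\<close>.
\<close>

lemma recenter:
  assumes F: "fps_nth F \<longlonglongrightarrow> (0::'a)" "F \<noteq> 0" and x: "absv x \<le> 1"
  obtains B where "B \<noteq> 0" "has_power_series_at (fps_value F) B x"
proof -
  define B where "B = regroup (fps_nth F) (\<lambda>n. [:x, 1:] ^ n)"
  have P: "integral_poly ([:x, 1:] ^ n)" for n
    using x by (intro integral_poly_power integral_poly_linear)
  have deg: "degree ([:x, 1:] ^ n) \<le> n" for n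
    using degree_power_le[of "[:x, 1:]" n] by simp
  have recentred: "fps_value B z = fps_value F (x + z)" if "absv z \<le> 1" for z
  proof -
    have "(\<lambda>n. fps_nth F n * poly ([:x, 1:] ^ n) z) sums fps_value B z"
      unfolding B_def by (rule regroup_value[OF F(1) P deg that])
    then have "(\<lambda>n. fps_nth F n * (x + z) ^ n) sums fps_value B z" by simp
    moreover have "absv (x + z) \<le> 1" using x that by (rule absv_add_leI)
    ultimately show ?thesis using sums_unique2 fps_value_sums[OF F(1)] by blast
  qed
  have B: "fps_nth B \<longlonglongrightarrow> 0" unfolding B_def by (rule regroup_null[OF F(1) P deg])
  have sums: "(\<lambda>n. fps_nth B n * z ^ n) sums fps_value F (x + z)" if "absv z \<le> 1" for z
    using fps_value_sums[OF B that] recentred[OF that] by simp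
  have "B \<noteq> 0"
  proof
    assume "B = 0"
    have "fps_value F y = 0" if "absv y \<le> 1" for y
    proof -
      have "absv (y - x) \<le> 1" using that x by (rule absv_diff_leI)
      from sums[OF this] show ?thesis
        using sums_unique2[OF _ sums_zero] by (simp add: \<open>B = 0\<close>)
    qed
    then have "(\<lambda>n. fps_nth F n * z ^ n) sums 0" if "absv z < 1" for z
      using fps_value_sums[OF F(1), of z] that by simp
    then have "F = 0" using zero_series[of 1] by simp
    then show False using F(2) by simp
  qed
  moreover have "has_power_series_at (fps_value F) B x"
    unfolding has_power_series_at_iff using sums by (intro exI[of _ 1]) simp
  ultimately show ?thesis using that by blast
qed

text \<open>
  In powers of \<open>y - x\<close> the factor \<open>y - a\<close> reads \<open>(x - a) + (y - x)\<close>, which is a unit unless \<open>x = a\<close>.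
\<close>

lemma vanishing_order_times_linear:
  assumes Q: "fps_nth Q \<longlonglongrightarrow> (0::'a)" "Q \<noteq> 0" and x: "absv x \<le> 1"
    and f: "\<And>y. absv y \<le> 1 \<Longrightarrow> f y = (y - a) * fps_value Q y"
  shows "vanishing_order f x = vanishing_order (fps_value Q) x + (if x = a then 1 else 0)"
proof -
  obtain B where B: "B \<noteq> 0" "has_power_series_at (fps_value Q) B x"
    using recenter[OF Q x] .
  let ?L = "fps_X + fps_const (x - a)"
  have L: "?L \<noteq> 0 \<and> subdegree ?L = (if x = a then 1 else 0)"
  proof (cases "x = a")
    case False
    then have "fps_nth ?L 0 \<noteq> 0" by simp
    then show ?thesis using False by (metis fps_zero_nth subdegree_eq_0)
  qed simp
  have "has_power_series_at f (?L * B) x"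
    using has_power_series_at_times_linear[OF B(2), of a]
    by (rule has_power_series_at_cong[of _ _ _ 1]) (simp_all add: f absv_add_leI x)
  then have "vanishing_order f x = subdegree (?L * B)"
    using L B(1) by (intro vanishing_order_eq_subdegree) simp_all
  also have "\<dots> = vanishing_order (fps_value Q) x + (if x = a then 1 else 0)"
    using L B by (simp add: vanishing_order_eq_subdegree)
  finally show ?thesis .
qed

end

context dense_root_field
begin

text \<open>
  Induction on the Weierstrass degree: for a zero \<open>a\<close> the zeros are \<open>a\<close> and those of the quotient by
  \<open>X - a\<close>, and passing to the quotient lowers the vanishing order at \<open>a\<close> by one and changes no other.
  The function \<open>f\<close> is only prescribed on the unit ball, as \<open>g\<close> is only given by a power series there.
\<close>

lemma zero_count:
  assumes "fps_nth F \<longlonglongrightarrow> (0::'a)" and "weierstrass_degree (fps_nth F) d"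
    and "\<And>y. absv y \<le> 1 \<Longrightarrow> f y = fps_value F y"
  shows "finite {x. absv x \<le> 1 \<and> f x = 0}"
    and "(\<Sum>x | absv x \<le> 1 \<and> f x = 0. vanishing_order f x) = d"
proof -
  have "finite {x. absv x \<le> 1 \<and> f x = 0} \<and> (\<Sum>x | absv x \<le> 1 \<and> f x = 0. vanishing_order f x) = d"
    using assms
  proof (induction d arbitrary: F f)
    case 0
    then have "{x. absv x \<le> 1 \<and> f x = 0} = {}"
      using fps_value_nonzero_if_degree_0 by auto
    then show ?case by (simp only: finite.emptyI sum.empty)
  next
    case (Suc d)
    obtain a where a: "absv a \<le> 1" "fps_value F a = 0"
      using zero_exists[OF Suc.prems(1,2)] by blast
    define Q where "Q = linear_quotient F a"
    define Z where "Z = {x. absv x \<le> 1 \<and> fps_value Q x = 0}"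
    have Q: "fps_nth Q \<longlonglongrightarrow> 0" "weierstrass_degree (fps_nth Q) d"
      unfolding Q_def using linear_quotient_null linear_quotient_weierstrass_degree Suc.prems a(1)
      by blast+
    then have Q_nz: "Q \<noteq> 0" by (auto simp: weierstrass_degree_def)
    have f: "f y = (y - a) * fps_value Q y" if "absv y \<le> 1" for y
      using fps_value_linear_quotient[OF Suc.prems(1) a(1) that] Suc.prems(3)[OF that] a(2)
      by (simp add: Q_def)
    have zeros: "{x. absv x \<le> 1 \<and> f x = 0} = insert a Z"
      using f a(1) by (auto simp: Z_def)
    have IH: "finite Z" "(\<Sum>x\<in>Z. vanishing_order (fps_value Q) x) = d"
      using Suc.IH[OF Q] by (simp_all add: Z_def)
    have order_a: "vanishing_order (fps_value Q) a = 0" if "a \<notin> Z"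
    proof -
      obtain B where "has_power_series_at (fps_value Q) B a"
        using recenter[OF Q(1) Q_nz a(1)] by blast
      then show ?thesis using that a(1) by (intro vanishing_order_eq_0) (auto simp: Z_def)
    qed
    have "(\<Sum>x\<in>insert a Z. vanishing_order f x) =
          (\<Sum>x\<in>insert a Z. vanishing_order (fps_value Q) x + (if x = a then 1 else 0))"
      using a(1) f by (intro sum.cong refl vanishing_order_times_linear Q(1) Q_nz) (auto simp: Z_def)
    also have "\<dots> = (\<Sum>x\<in>insert a Z. vanishing_order (fps_value Q) x) + 1"
      using IH(1) by (simp add: sum.distrib)
    also have "(\<Sum>x\<in>insert a Z. vanishing_order (fps_value Q) x) = d"
      using IH order_a by (cases "a \<in> Z") (simp_all add: insert_absorb)
    finally show ?case using IH(1) by (simp add: zeros)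
  qed
  then show "finite {x. absv x \<le> 1 \<and> f x = 0}"
    and "(\<Sum>x | absv x \<le> 1 \<and> f x = 0. vanishing_order f x) = d" by blast+
qed

end

section \<open>Absolute values of factorials\<close>

text \<open>
  Among \<open>1, \<dots>, m\<close> only the multiples \<open>p, 2p, \<dots>, kp\<close> with \<open>k = m div p\<close> contribute, and their product
  is \<open>p\<^sup>k k!\<close>.
\<close>

lemma multiplicity_fact_div:
  fixes p :: nat
  assumes p: "prime p"
  shows "multiplicity p (fact m) = m div p + multiplicity p (fact (m div p) :: nat)"
proof (induction m)
  case (Suc m)
  have pe: "prime_elem p" using p by simp
  have mult_Suc: "multiplicity p (fact (Suc k) :: nat) = multiplicity p (Suc k) + multiplicity p (fact k :: nat)" for k
    unfolding fact_Suc of_nat_id by (rule prime_elem_multiplicity_mult_distrib[OF pe]) simp_all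
  show ?case
  proof (cases "p dvd Suc m")
    case False
    then have "Suc m div p = m div p" by (simp add: div_Suc dvd_eq_mod_eq_0)
    then show ?thesis using Suc.IH mult_Suc[of m] False by (simp add: not_dvd_imp_multiplicity_0 del: fact_Suc)
  next
    case True
    then obtain j where j: "Suc m = p * j" by blast
    then obtain i where i: "j = Suc i" by (cases j) auto
    have "m div p = i"
      using j i prime_gt_0_nat[OF p] True by (simp add: div_Suc dvd_eq_mod_eq_0 split: if_splits)
         (metis Suc_inject div_Suc div_mult_self1_is_m dvd_eq_mod_eq_0 True j)
    moreover have "Suc m div p = Suc i" using j i prime_gt_0_nat[OF p] by simp
    moreover have "multiplicity p (Suc m) = Suc (multiplicity p (Suc i))"
      unfolding j i using prime_gt_0_nat[OF p] prime_gt_1_nat[OF p] by (intro multiplicity_times_same) auto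
    ultimately show ?thesis
      using Suc.IH mult_Suc[of m] mult_Suc[of i] by (simp del: fact_Suc)
  qed
qed simp

text \<open>
  This is Legendre's formula \<open>(p - 1) v (m!) = m - s\<^sub>p(m)\<close>, with the digit sum \<open>s\<^sub>p(m)\<close> in base \<open>p\<close>
  replaced by its lower bound 1.
\<close>

lemma multiplicity_fact_bound:
  fixes p :: nat
  assumes p: "prime p" and m: "0 < m"
  shows "(p - 1) * multiplicity p (fact m :: nat) + 1 \<le> m"
  using m
proof (induction m rule: less_induct)
  case (less m)
  define k where "k = m div p"
  define w where "w = multiplicity p (fact k :: nat)"
  have rec: "multiplicity p (fact m :: nat) = k + w"
    unfolding k_def w_def by (rule multiplicity_fact_div[OF p])
  show ?case
  proof (cases "k = 0")
    case True
    then show ?thesis using rec less.prems by (simp add: w_def)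
  next
    case False
    have "k < m" using less.prems prime_gt_1_nat[OF p] by (simp add: k_def)
    then have "(p - 1) * w + 1 \<le> k"
      using less.IH[of k] False by (simp add: w_def)
    then have "(p - 1) * (k + w) + 1 \<le> (p - 1) * k + k" by (simp add: distrib_left)
    also have "\<dots> = p * k" using prime_gt_0_nat[OF p] by (cases p) simp_all
    also have "\<dots> \<le> m" by (simp add: k_def)
    finally show ?thesis by (simp add: rec)
  qed
qed

locale padic_field = ultrametric_field K
  for K :: "'a::{field_char_0, complete_space} itself" +
  fixes p :: nat
  assumes p: "prime p" and absv_p: "absv (of_nat p :: 'a) = 1 / real p"
begin

lemma p_gt_1: "1 < real p"
  using prime_gt_1_nat[OF p] by simp

text \<open>
  By Bezout \<open>n x = 1 + p y\<close> for integers \<open>x\<close>, \<open>y\<close>, and the right-hand side has absolute value 1. Both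
  factors on the left have absolute value at most 1, so they must both attain it.
\<close>

lemma absv_of_nat_not_dvd:
  assumes "\<not> p dvd n"
  shows "absv (of_nat n :: 'a) = 1"
proof -
  have "n \<noteq> 0" using assms by (metis dvd_0_right)
  then obtain x y where xy: "n * x = p * y + gcd n p" using bezout_nat by blast
  have "coprime p n" using p assms by (simp add: prime_imp_coprime)
  then have "of_nat n * of_nat x = (1 + of_nat p * of_nat y :: 'a)"
    using arg_cong[OF xy, of "of_nat :: nat \<Rightarrow> 'a"] by (simp add: coprime_commute)
  moreover have "absv (of_nat p * of_nat y :: 'a) < absv (1::'a)"
    using absv_mult_le_left[OF absv_of_nat_le_1, of "of_nat p" y] absv_p p_gt_1
    by (auto intro: le_less_trans)
  ultimately have "absv (of_nat n :: 'a) * absv (of_nat x :: 'a) = 1"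
    using absv_add_eq_left by (metis absv_mult absv_one)
  then show ?thesis
    using absv_of_nat_le_1[of n] absv_of_nat_le_1[of x] absv_mult_le_left[OF absv_of_nat_le_1, of "of_nat n" x]
    by (simp add: absv_mult)
qed

lemma absv_of_nat:
  assumes "0 < n"
  shows "absv (of_nat n :: 'a) = (1 / real p) ^ multiplicity p n"
proof -
  obtain m where m: "n = p ^ multiplicity p n * m" "\<not> p dvd m"
    using multiplicity_decompose'[of n p] assms prime_gt_1_nat[OF p] by auto
  have "absv (of_nat n :: 'a) = absv (of_nat p ^ multiplicity p n * of_nat m :: 'a)"
    by (subst m(1)) simp
  then show ?thesis using absv_of_nat_not_dvd[OF m(2)] by (simp add: absv_mult absv_power absv_p)
qed

lemma absv_fact: "absv (fact n :: 'a) = (1 / real p) ^ multiplicity p (fact n :: nat)"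
  using absv_of_nat[of "fact n"] by simp

lemma absv_fact_less_p: "n < p \<Longrightarrow> absv (fact n :: 'a) = 1"
  using prime_dvd_fact_iff[OF p, of n] by (simp add: absv_fact not_dvd_imp_multiplicity_0)

lemma absv_fact_p: "absv (fact p :: 'a) = 1 / real p"
  using multiplicity_fact_div[OF p, of p] prime_gt_0_nat[OF p] by (simp add: absv_fact)

text \<open>
  The inverse of the radius of convergence of the p-adic exponential.
\<close>

definition exp_scale :: real where
  "exp_scale = real p powr (1 / (real p - 1))"

lemma exp_scale_gt_1: "1 < exp_scale"
  using p_gt_1 by (simp add: exp_scale_def)

lemma exp_scale_power: "exp_scale ^ (p - 1) = real p"
proof -
  have "exp_scale ^ (p - 1) = exp_scale powr real (p - 1)"
    using exp_scale_gt_1 by (simp add: powr_realpow)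
  also have "\<dots> = real p" using p_gt_1 by (simp add: exp_scale_def powr_powr of_nat_diff)
  finally show ?thesis .
qed

lemma inverse_absv_fact_le:
  assumes "0 < n"
  shows "1 / absv (fact n :: 'a) \<le> exp_scale ^ (n - 1)"
proof -
  define v where "v = multiplicity p (fact n :: nat)"
  have "1 / absv (fact n :: 'a) = exp_scale ^ ((p - 1) * v)"
    unfolding power_mult exp_scale_power by (simp add: absv_fact v_def power_one_over)
  also have "\<dots> \<le> exp_scale ^ (n - 1)"
    using multiplicity_fact_bound[OF p assms] exp_scale_gt_1
    by (intro power_increasing) (auto simp: v_def)
  finally show ?thesis .
qed

lemma inner_radius_power:
  assumes "2 < p"
  shows "(real p powr (- 1 / (real p - 2))) ^ (p - 2) = 1 / real p"
proof -
  have "(real p powr (- 1 / (real p - 2))) ^ (p - 2) = (real p powr (- 1 / (real p - 2))) powr real (p - 2)"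
    using p_gt_1 by (intro powr_realpow[symmetric]) simp
  also have "\<dots> = real p powr (- 1 / (real p - 2) * real (p - 2))"
    by (rule powr_powr)
  also have "- 1 / (real p - 2) * real (p - 2) = - 1"
    using assms by (simp add: of_nat_diff)
  finally show ?thesis using p_gt_1 by (simp add: powr_minus_divide)
qed

end

section \<open>The Weierstrass degree of the fixed point equation\<close>

context padic_field
begin

text \<open>
  With \<open>u = q - 1\<close>, these are the coefficients of \<open>g X q\<close> in the basis formed by the products
  \<open>(X - 2) \<dots> (X - (n + 1))\<close>.
\<close>

definition newton_coeff :: "'a \<Rightarrow> nat \<Rightarrow> 'a" where
  "newton_coeff u n = u ^ n / fact (n + 2)"

lemma absv_newton_coeff: "absv (newton_coeff u n) = absv u ^ n * (1 / absv (fact (n + 2) :: 'a))"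
  by (simp add: newton_coeff_def absv_divide absv_power)

lemma newton_coeff_nonzero: "u \<noteq> 0 \<or> n = 0 \<Longrightarrow> newton_coeff u n \<noteq> 0"
  by (auto simp: newton_coeff_def simp del: fact_Suc add_2_eq_Suc')

lemma absv_newton_coeff_le: "absv (newton_coeff u n) \<le> exp_scale * (exp_scale * absv u) ^ n"
proof -
  have "absv (newton_coeff u n) \<le> absv u ^ n * exp_scale ^ (n + 1)"
    unfolding absv_newton_coeff using inverse_absv_fact_le[of "n + 2"] by (intro mult_left_mono) simp_all
  then show ?thesis by (simp add: power_mult_distrib mult_ac)
qed

lemma absv_newton_coeff_less_p: "n + 2 < p \<Longrightarrow> absv (newton_coeff u n) = absv u ^ n"
  unfolding absv_newton_coeff by (subst absv_fact_less_p) simp_all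

text \<open>
  The first factorial divisible by \<open>p\<close> is \<open>p!\<close>, in the coefficient of index \<open>p - 2\<close>.
\<close>

lemma absv_newton_coeff_p: "absv (newton_coeff u (p - 2)) = real p * absv u ^ (p - 2)"
proof -
  have "p - 2 + 2 = p" using prime_ge_2_nat[OF p] by simp
  then show ?thesis unfolding absv_newton_coeff by (simp only: absv_fact_p) simp
qed

context
  fixes u :: 'a
  assumes u: "absv u < real p powr (- 1 / (real p - 1))"
begin

lemma scaled_less_1: "exp_scale * absv u < 1"
proof -
  have "absv u < 1 / exp_scale"
    using u by (simp add: exp_scale_def powr_minus_divide)
  then show ?thesis using exp_scale_gt_1 by (simp add: field_simps)
qed

lemma scaled_nonneg: "0 \<le> exp_scale * absv u"
  using exp_scale_gt_1 by simp

lemma u_less_1: "absv u < 1"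
proof (rule le_less_trans[OF _ scaled_less_1])
  show "absv u \<le> exp_scale * absv u"
    using exp_scale_gt_1 mult_right_mono[of 1 exp_scale "absv u"] by simp
qed

lemma newton_coeff_null: "newton_coeff u \<longlonglongrightarrow> 0"
proof (rule null_seq_iff_absv[THEN iffD2], rule Lim_null_comparison)
  show "\<forall>\<^sub>F n in sequentially. norm (absv (newton_coeff u n)) \<le> exp_scale * (exp_scale * absv u) ^ n"
    using absv_newton_coeff_le by simp
  have "(\<lambda>n. exp_scale * (exp_scale * absv u) ^ n) \<longlonglongrightarrow> exp_scale * 0"
    using scaled_less_1 scaled_nonneg by (intro tendsto_mult_left LIMSEQ_power_zero) simp
  then show "(\<lambda>n. exp_scale * (exp_scale * absv u) ^ n) \<longlonglongrightarrow> 0" by simp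
qed

text \<open>
  The bound \<open>absv_newton_coeff_le\<close> decreases strictly with \<open>n\<close>, and at \<open>n = p - 2\<close> it equals the right-hand
  side.
\<close>

lemma absv_newton_coeff_beyond_p:
  assumes "p - 2 < n" and "u \<noteq> 0"
  shows "absv (newton_coeff u n) < real p * absv u ^ (p - 2)"
proof -
  have "p - 1 = Suc (p - 2)" using prime_ge_2_nat[OF p] by simp
  then have "real p = exp_scale * exp_scale ^ (p - 2)"
    using exp_scale_power by simp
  then have eq: "real p * absv u ^ (p - 2) = exp_scale * (exp_scale * absv u) ^ (p - 2)"
    by (simp add: power_mult_distrib)
  have "(exp_scale * absv u) ^ n < (exp_scale * absv u) ^ (p - 2)"
    using assms scaled_less_1 exp_scale_gt_1 by (intro power_strict_decreasing) auto
  then have "exp_scale * (exp_scale * absv u) ^ n < real p * absv u ^ (p - 2)"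
    unfolding eq using exp_scale_gt_1 by (intro mult_strict_left_mono) auto
  then show ?thesis using absv_newton_coeff_le[of u n] by linarith
qed

text \<open>
  Here \<open>p - 2 = 0\<close>: the constant term \<open>1 / 2\<close> is itself the coefficient that dominates all later
  ones.
\<close>

lemma newton_coeff_degree_2:
  assumes "p = 2"
  shows "weierstrass_degree (newton_coeff u) 0"
proof -
  have 0: "absv (newton_coeff u 0) = 2"
    using absv_newton_coeff_p[of u] assms by simp
  have less: "absv (newton_coeff u n) < 2" if "0 < n" for n
  proof (cases "u = 0")
    case False
    then show ?thesis using absv_newton_coeff_beyond_p[of n] assms that by simp
  qed (use that in \<open>simp add: newton_coeff_def power_0_left\<close>)
  show ?thesis
    unfolding weierstrass_degree_def 0
  proof (intro conjI allI impI less)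
    show "newton_coeff u 0 \<noteq> 0" by (simp add: newton_coeff_nonzero)
    show "absv (newton_coeff u n) \<le> 2" for n using 0 less[of n] by (cases "n = 0") auto
  qed
qed

text \<open>
  In the inner disc \<open>p |u|\<^bsup>p-2\<^esup> < 1\<close>, so the constant term \<open>1 / 2\<close>, a unit for odd \<open>p\<close>, dominates.
\<close>

lemma newton_coeff_degree_near:
  assumes odd: "p \<noteq> 2" and near: "absv u < real p powr (- 1 / (real p - 2))"
  shows "weierstrass_degree (newton_coeff u) 0"
proof -
  have p2: "2 < p" using prime_ge_2_nat[OF p] odd by simp
  have "absv u ^ (p - 2) < (real p powr (- 1 / (real p - 2))) ^ (p - 2)"
    using near p2 by (intro power_strict_mono) auto
  also have "\<dots> = 1 / real p"
    by (rule inner_radius_power[OF p2])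
  finally have p_small: "real p * absv u ^ (p - 2) < 1"
    using p_gt_1 by (simp add: field_simps)
  have 0: "absv (newton_coeff u 0) = 1"
    using absv_newton_coeff_less_p[of 0 u] p2 by simp
  have less: "absv (newton_coeff u n) < 1" if n: "0 < n" for n
  proof (cases "u = 0")
    case False
    consider "n + 2 < p" | "n = p - 2" | "p - 2 < n" by linarith
    then show ?thesis
    proof cases
      case 1
      then show ?thesis using absv_newton_coeff_less_p[of n u] u_less_1 n by (simp add: power_less_one_iff)
    next
      case 2
      then show ?thesis using absv_newton_coeff_p[of u] p_small by simp
    next
      case 3
      then show ?thesis using absv_newton_coeff_beyond_p[OF _ False] p_small by fastforce
    qed
  qed (use n in \<open>simp add: newton_coeff_def power_0_left\<close>)
  show ?thesis
    unfolding weierstrass_degree_def 0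
  proof (intro conjI allI impI less)
    show "newton_coeff u 0 \<noteq> 0" by (simp add: newton_coeff_nonzero)
    show "absv (newton_coeff u n) \<le> 1" for n using 0 less[of n] by (cases "n = 0") auto
  qed
qed

text \<open>
  Outside the inner disc \<open>p |u|\<^bsup>p-2\<^esup> \<ge> 1\<close>, and the earlier coefficients have absolute value
  \<open>|u|\<^sup>n \<le> 1\<close>. On the boundary circle the coefficients of index 0 and \<open>p - 2\<close> tie and the last
  one counts.
\<close>

lemma newton_coeff_degree_far:
  assumes odd: "p \<noteq> 2" and far: "real p powr (- 1 / (real p - 2)) \<le> absv u"
  shows "weierstrass_degree (newton_coeff u) (p - 2)"
proof -
  have p2: "2 < p" using prime_ge_2_nat[OF p] odd by simp
  have "1 / real p = (real p powr (- 1 / (real p - 2))) ^ (p - 2)"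
    by (rule inner_radius_power[OF p2, symmetric])
  also have "\<dots> \<le> absv u ^ (p - 2)"
    using far by (intro power_mono) auto
  finally have p_large: "1 \<le> real p * absv u ^ (p - 2)"
    using p_gt_1 by (simp add: field_simps)
  have "0 < real p powr (- 1 / (real p - 2))" using p_gt_1 by simp
  then have "u \<noteq> 0" using far by auto
  have "absv (newton_coeff u n) \<le> real p * absv u ^ (p - 2)" for n
  proof -
    consider "n + 2 < p" | "n = p - 2" | "p - 2 < n" by linarith
    then show ?thesis
    proof cases
      case 1
      then have "absv (newton_coeff u n) \<le> 1"
        using absv_newton_coeff_less_p[of n u] u_less_1 by (simp add: power_le_one)
      then show ?thesis using p_large by linarith
    next
      case 2
      then show ?thesis using absv_newton_coeff_p[of u] by simp
    next
      case 3
      then show ?thesis using absv_newton_coeff_beyond_p[OF _ \<open>u \<noteq> 0\<close>] by fastforce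
    qed
  qed
  then show ?thesis
    using absv_newton_coeff_beyond_p[OF _ \<open>u \<noteq> 0\<close>] \<open>u \<noteq> 0\<close>
    unfolding weierstrass_degree_def absv_newton_coeff_p by (simp add: newton_coeff_nonzero)
qed

end

definition newton_poly :: "nat \<Rightarrow> 'a poly" where
  "newton_poly n = (\<Prod>k = 2..n + 1. [:- of_nat k, 1:])"

lemma poly_newton_poly: "poly (newton_poly n) x = g_coeff n x"
  unfolding newton_poly_def g_coeff_def poly_prod by (rule prod.cong) simp_all

lemma integral_newton_poly: "integral_poly (newton_poly n)"
  unfolding newton_poly_def by (intro integral_poly_prod integral_poly_linear) (simp add: absv_of_nat_le_1)

lemma degree_newton_poly: "degree (newton_poly n) = n"
  unfolding newton_poly_def by (subst degree_prod_eq_sum_degree) simp_all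

lemma coeff_newton_poly: "coeff (newton_poly n) n = 1"
proof -
  have "lead_coeff (newton_poly n) = 1"
    unfolding newton_poly_def lead_coeff_prod by (rule prod.neutral) simp
  then show ?thesis by (simp only: degree_newton_poly)
qed

definition g_series :: "'a \<Rightarrow> 'a fps" where
  "g_series q = regroup (newton_coeff (q - 1)) newton_poly"

lemma g_series:
  assumes q: "absv (q - 1) < real p powr (- 1 / (real p - 1))"
  shows "fps_nth (g_series q) \<longlonglongrightarrow> 0"
    and "absv x \<le> 1 \<Longrightarrow> g x q = fps_value (g_series q) x"
    and "weierstrass_degree (newton_coeff (q - 1)) d \<Longrightarrow> weierstrass_degree (fps_nth (g_series q)) d"
proof -
  note facts = newton_coeff_null[OF q] integral_newton_poly eq_refl[OF degree_newton_poly]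
  show "fps_nth (g_series q) \<longlonglongrightarrow> 0"
    unfolding g_series_def by (rule regroup_null[OF facts])
  show "weierstrass_degree (fps_nth (g_series q)) d" if "weierstrass_degree (newton_coeff (q - 1)) d"
    unfolding g_series_def by (rule regroup_weierstrass_degree[OF facts coeff_newton_poly that])
  show "g x q = fps_value (g_series q) x" if "absv x \<le> 1"
  proof -
    have "g_coeff n x / fact (n + 2) * (q - 1) ^ n = newton_coeff (q - 1) n * poly (newton_poly n) x" for n
      by (simp add: newton_coeff_def poly_newton_poly mult.commute del: fact_Suc add_2_eq_Suc')
    then have "g x q = (\<Sum>n. newton_coeff (q - 1) n * poly (newton_poly n) x)"
      by (simp only: g_def)
    also have "\<dots> = fps_value (g_series q) x"
      unfolding g_series_def by (rule sums_unique[OF regroup_value[OF facts that], symmetric])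
    finally show ?thesis .
  qed
qed

end

section \<open>The fibers of the projection\<close>

locale padic_complex = padic_field K p + dense_root_field K A
  for K :: "'a::{field_char_0, complete_space} itself" and p :: nat and A :: "'a set"
begin

lemma fiber_count:
  assumes q: "absv (q - 1) < real p powr (- 1 / (real p - 1))"
    and d: "weierstrass_degree (newton_coeff (q - 1)) d"
  shows "finite {x. absv x \<le> 1 \<and> g x q = 0}"
    and "(\<Sum>x | absv x \<le> 1 \<and> g x q = 0. vanishing_order (\<lambda>X. g X q) x) = d"
    and "{x. absv x \<le> 1 \<and> g x q = 0} = {} \<longleftrightarrow> d = 0"
proof -
  note series = g_series(1)[OF q] g_series(3)[OF q d]
  show "finite {x. absv x \<le> 1 \<and> g x q = 0}"
    and sum: "(\<Sum>x | absv x \<le> 1 \<and> g x q = 0. vanishing_order (\<lambda>X. g X q) x) = d"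
    using zero_count[OF series g_series(2)[OF q]] by simp_all
  show "{x. absv x \<le> 1 \<and> g x q = 0} = {} \<longleftrightarrow> d = 0"
  proof
    assume "d = 0"
    then show "{x. absv x \<le> 1 \<and> g x q = 0} = {}"
      using fps_value_nonzero_if_degree_0[OF series(1)] series(2) g_series(2)[OF q] by auto
  next
    assume "{x. absv x \<le> 1 \<and> g x q = 0} = {}"
    then show "d = 0" using sum by (metis sum.empty)
  qed
qed

end

lemma padic_complex_field_imp:
  assumes p: "prime p" and K: "padic_complex_field p TYPE('a::{field_char_0, complete_space})"
  shows "padic_complex p (padic_algebraic :: 'a set)"
proof
  show "0 \<in> (padic_algebraic :: 'a set)"
  proof -
    have "(0::'a) \<in> padic_numbers" "(1::'a) \<in> padic_numbers"
      unfolding padic_numbers_def by (auto intro: subsetD[OF closure_subset])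
    then have "\<forall>i. coeff [:0, 1 :: 'a:] i \<in> padic_numbers"
      by (auto simp: coeff_pCons split: nat.split)
    then show ?thesis
      unfolding padic_algebraic_def by (intro CollectI exI[of _ "[:0, 1:]"]) simp
  qed
  show "\<exists>\<pi> :: 'a. \<pi> \<noteq> 0 \<and> absv \<pi> < 1"
    using K prime_gt_1_nat[OF p] unfolding padic_complex_field_def
    by (intro exI[of _ "of_nat p"]) auto
  show "\<exists>x. poly f x = 0" if "degree f > 0" "\<And>i. coeff f i \<in> padic_algebraic" for f :: "'a poly"
    using K that unfolding padic_complex_field_def by blast
qed (use assms in \<open>auto simp: padic_complex_field_def\<close>)

theorem proposition3:
  fixes p :: nat and M :: "('a::{field_char_0, complete_space} \<times> 'a) set"
  assumes "prime p"
    and "padic_complex_field p TYPE('a)"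
    and "M = nontrivial_fixed_points p"
  shows "(p = 2 \<longrightarrow> M = {}) \<and>
    (p \<noteq> 2 \<longrightarrow>
      (\<forall>q \<in> snd ` M.
         finite (M \<inter> snd -` {q}) \<and>
         (\<Sum>(x, q') \<in> M \<inter> snd -` {q}. vanishing_order (\<lambda>X. g X q') x) = p - 2) \<and>
      snd ` M = ball 1 (real p powr (- 1 / (real p - 1))) - ball 1 (real p powr (- 1 / (real p - 2))))"
proof -
  interpret padic_complex "TYPE('a)" p padic_algebraic
    by (rule padic_complex_field_imp[OF assms(1,2)])
  define Z where "Z q = {x::'a. absv x \<le> 1 \<and> g x q = 0}" for q
  have ball_iff: "q \<in> ball 1 r \<longleftrightarrow> absv (q - 1) < r" for q :: 'a and r
    by (simp add: dist_absv absv_minus_commute)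
  have M_iff: "(x, q) \<in> M \<longleftrightarrow> absv (q - 1) < real p powr (- 1 / (real p - 1)) \<and> x \<in> Z q" for x q
    unfolding assms(3) nontrivial_fixed_points_def Z_def
    by (simp add: ball_iff mem_unit_ball_iff del: mem_ball mem_cball) blast
  show ?thesis
  proof (intro conjI impI ballI)
    assume "p = 2"
    have "(x, q) \<notin> M" for x q
    proof
      assume x: "(x, q) \<in> M"
      then have q: "absv (q - 1) < real p powr (- 1 / (real p - 1))" by (simp add: M_iff)
      have "Z q = {}"
        unfolding Z_def using fiber_count(3)[OF q newton_coeff_degree_2[OF q \<open>p = 2\<close>]] by simp
      then show False using x by (simp add: M_iff)
    qed
    then show "M = {}" by auto
  next
    assume odd: "p \<noteq> 2"
    have p2: "2 < p" using prime_ge_2_nat[OF p] odd by simp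
    have far: "real p powr (- 1 / (real p - 2)) \<le> absv (q - 1) \<longleftrightarrow> Z q \<noteq> {}"
      if q: "absv (q - 1) < real p powr (- 1 / (real p - 1))" for q
      using fiber_count(3)[OF q newton_coeff_degree_far[OF q odd]]
        fiber_count(3)[OF q newton_coeff_degree_near[OF q odd]] p2
      unfolding Z_def by fastforce
    show "snd ` M = ball 1 (real p powr (- 1 / (real p - 1))) - ball 1 (real p powr (- 1 / (real p - 2)))"
    proof (intro set_eqI)
      fix q
      have "q \<in> snd ` M \<longleftrightarrow> (\<exists>x. (x, q) \<in> M)" by force
      also have "\<dots> \<longleftrightarrow> absv (q - 1) < real p powr (- 1 / (real p - 1)) \<and> Z q \<noteq> {}"
        by (auto simp: M_iff)
      also have "\<dots> \<longleftrightarrow> q \<in> ball 1 (real p powr (- 1 / (real p - 1))) - ball 1 (real p powr (- 1 / (real p - 2)))"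
        unfolding Diff_iff ball_iff using far[of q] by (auto simp: not_less)
      finally show "q \<in> snd ` M \<longleftrightarrow>
        q \<in> ball 1 (real p powr (- 1 / (real p - 1))) - ball 1 (real p powr (- 1 / (real p - 2)))" .
    qed
    fix q assume "q \<in> snd ` M"
    then obtain x where "(x, q) \<in> M" by force
    then have q: "absv (q - 1) < real p powr (- 1 / (real p - 1))" and "Z q \<noteq> {}"
      by (auto simp: M_iff)
    then have d: "weierstrass_degree (newton_coeff (q - 1)) (p - 2)"
      using far[OF q] by (intro newton_coeff_degree_far[OF q odd]) simp
    have fiber: "M \<inter> snd -` {q} = (\<lambda>x. (x, q)) ` Z q"
      using q by (auto simp: M_iff)
    show "finite (M \<inter> snd -` {q})"
      unfolding fiber using fiber_count(1)[OF q d] by (simp add: Z_def)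
    show "(\<Sum>(x, q') \<in> M \<inter> snd -` {q}. vanishing_order (\<lambda>X. g X q') x) = p - 2"
      unfolding fiber using fiber_count(2)[OF q d]
      by (subst sum.reindex) (auto simp: inj_on_def Z_def)
  qed
qed

end
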